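(* Consider the integro-differential equation $$F(x,u,\nabla u,\nabla^2 u)-\int_{\mathbf{R}^N}\bigl[u(x+z)-u(x)-\mathbf 1_{|z|\le 1}\langle \nabla u(x),z\rangle\bigr]q(z)\,dz=0,\qquad x\in\Omega, \qquad (E)$$ with $\Omega$, $F$, $q$ as specified in the context, and the notions of viscosity subsolution and supersolution of (E) in the sense of Definition B and of Definition C given in the context. Then: (i) If $u$ is a viscosity subsolution (resp. supersolution) of (E) in the sense of Definition B, then $u$ is a viscosity subsolution (resp. supersolution) of (E) in the sense of Definition C. (ii) If $u$ is a viscosity subsolution (resp. supersolution) of (E) in the sense of Definition C, then $u$ is a viscosity subsolution (resp. supersolution) of (E) in the sense of Definition B.
   Context: Setting: $\Omega\subset\mathbf{R}^N$; $\mathbf{S}^N$ is the space of real symmetric $N\times N$ matrices; $F\in C(\Omega\times\mathbf{R}\times\mathbf{R}^N\times\mathbf{S}^N)$ is a second-order fully nonlinear elliptic operator (ellipticity in the usual sense of viscosity solution theory: $F(x,r,p,X)\ge F(x,r,p,Y)$ whenever $X\le Y$). The Lévy measure $q(z)\,dz$ is a positive Radon measure with $\int_{|z|<1}|z|^2q(z)\,dz+\int_{|z|\ge 1}q(z)\,dz<\infty$. $\mathbf 1_{|z|\le 1}$ is the indicator function of $\{|z|\le 1\}$. $USC(\mathbf{R}^N)$ and $LSC(\mathbf{R}^N)$ denote the upper and lower semicontinuous functions on $\mathbf{R}^N$. Definition B. $u\in USC(\mathbf{R}^N)$ (resp. $v\in LSC(\mathbf{R}^N)$) is a viscosity subsolution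 (resp. supersolution) of (E) if for any $\hat x\in\Omega$ and any $\phi\in C^2(\mathbf{R}^N)$ such that $u(\hat x)=\phi(\hat x)$ and $u-\phi$ takes a global maximum at $\hat x$ (resp. $v(\hat x)=\phi(\hat x)$ and $v-\phi$ takes a global minimum at $\hat x$), $$F(\hat x,u(\hat x),\nabla\phi(\hat x),\nabla^2\phi(\hat x))-\int_{\mathbf{R}^N}[\phi(\hat x+z)-\phi(\hat x)-\mathbf 1_{|z|\le1}\langle z,\nabla\phi(\hat x)\rangle]q(z)\,dz\le 0$$ (resp. $$F(\hat x,v(\hat x),\nabla\phi(\hat x),\nabla^2\phi(\hat x))-\int_{\mathbf{R}^N}[\phi(\hat x+z)-\phi(\hat x)-\mathbf 1_{|z|\le1}\langle z,\nabla\phi(\hat x)\rangle]q(z)\,dz\ge 0).$$ Definition C. $u\in USC(\mathbf{R}^N)$ (resp. $v\in LSC(\mathbf{R}^N)$) is a viscosity subsolution (resp. supersolution) of (E) if for any $\hat x\in\Omega$ and any $\phi\in C^2(\mathbf{R}^N)$ such that $u(\hat x)=\phi(\hat x)$ and $u-\phi$ takes a global maximum at $\hat x$ (resp. $v(\hat x)=\phi(\hat x)$ and $v-\phi$ takes a global minimum at $\hat x$), the function $h(z)=u(\hat x+z)-u(\hat x)-\mathbf 1_{|z|\le1}\langle z,\nabla\phi(\hat x)\rangle$ (resp. the same with $v$ in place of $u$) belongs to $L^1(\mathbf{R}^N,q(z)dz)$ and $$F(\hat x,u(\hat x),\nabla\phi(\hat x),\nabla^2\phi(\hat x))-\int_{\mathbf{R}^N}[u(\hat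 x+z)-u(\hat x)-\mathbf 1_{|z|\le1}\langle z,\nabla\phi(\hat x)\rangle]q(z)\,dz\le 0$$ (resp. $$F(\hat x,v(\hat x),\nabla\phi(\hat x),\nabla^2\phi(\hat x))-\int_{\mathbf{R}^N}[v(\hat x+z)-v(\hat x)-\mathbf 1_{|z|\le1}\langle z,\nabla\phi(\hat x)\rangle]q(z)\,dz\ge 0).$$
   Formalization: In Definition B the integral of φ, which may diverge, is taken in [-∞,∞] and must not be of the form ∞-∞; and at each point of Ω admitting test functions at least one must have a finite integral, since otherwise (i) fails for fast-growing u. *)

theory Defs
  imports "HOL-Analysis.Analysis"
begin

text \<open>The operator \<open>F\<close> is a total function on \<open>real^'n^'n\<close>, but only its values on
  \<open>\<Omega> \<times> UNIV \<times> UNIV \<times> sym_matrices\<close> are constrained.\<close>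

definition sym_matrices :: "(real^'n^'n) set" where
  "sym_matrices = {X. transpose X = X}"

definition loewner_le :: "real^'n^'n \<Rightarrow> real^'n^'n \<Rightarrow> bool" where
  "loewner_le X Y \<longleftrightarrow> (\<forall>\<xi>. \<xi> \<bullet> (X *v \<xi>) \<le> \<xi> \<bullet> (Y *v \<xi>))"

definition continuous_operator ::
    "(real^'n) set \<Rightarrow> (real^'n \<Rightarrow> real \<Rightarrow> real^'n \<Rightarrow> real^'n^'n \<Rightarrow> real) \<Rightarrow> bool" where
  "continuous_operator \<Omega> F \<longleftrightarrow>
     continuous_on (\<Omega> \<times> UNIV \<times> UNIV \<times> sym_matrices) (\<lambda>(x, r, p, X). F x r p X)"

definition elliptic_operator ::
    "(real^'n) set \<Rightarrow> (real^'n \<Rightarrow> real \<Rightarrow> real^'n \<Rightarrow> real^'n^'n \<Rightarrow> real) \<Rightarrow> bool" where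
  "elliptic_operator \<Omega> F \<longleftrightarrow>
     (\<forall>x\<in>\<Omega>. \<forall>r p. \<forall>X\<in>sym_matrices. \<forall>Y\<in>sym_matrices.
        loewner_le X Y \<longrightarrow> F x r p Y \<le> F x r p X)"

text \<open>As usual for Levy measures, \<open>q\<close> may have infinite mass near the origin; local
  finiteness away from the origin follows from the integrability condition.\<close>

definition levy_density :: "(real^'n \<Rightarrow> real) \<Rightarrow> bool" where
  "levy_density q \<longleftrightarrow>
     q \<in> borel_measurable borel \<and> (\<forall>z. 0 \<le> q z) \<and>
     (\<integral>\<^sup>+z\<in>{z. norm z < 1}. ennreal ((norm z)\<^sup>2 * q z) \<partial>lborel)
       + (\<integral>\<^sup>+z\<in>{z. 1 \<le> norm z}. ennreal (q z) \<partial>lborel) < \<infinity>"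

definition levy_measure :: "(real^'n \<Rightarrow> real) \<Rightarrow> (real^'n) measure" where
  "levy_measure q = density lborel (\<lambda>z. ennreal (q z))"

definition USC :: "('a::topological_space \<Rightarrow> real) set" where
  "USC = {u. \<forall>x c. u x < c \<longrightarrow> (\<forall>\<^sub>F y in nhds x. u y < c)}"

definition LSC :: "('a::topological_space \<Rightarrow> real) set" where
  "LSC = {v. \<forall>x c. c < v x \<longrightarrow> (\<forall>\<^sub>F y in nhds x. c < v y)}"

definition grad :: "(real^'n \<Rightarrow> real) \<Rightarrow> real^'n \<Rightarrow> real^'n" where
  "grad \<phi> x = (THE D. GDERIV \<phi> x :> D)"

definition hessian :: "(real^'n \<Rightarrow> real) \<Rightarrow> real^'n \<Rightarrow> real^'n^'n" where
  "hessian \<phi> x = jacobian (grad \<phi>) (at x)"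

definition C2 :: "(real^'n \<Rightarrow> real) set" where
  "C2 = {\<phi>. (\<forall>x. \<phi> differentiable (at x)) \<and> (\<forall>x. grad \<phi> differentiable (at x)) \<and>
             continuous_on UNIV (hessian \<phi>)}"

definition touches_above :: "(real^'n \<Rightarrow> real) \<Rightarrow> (real^'n \<Rightarrow> real) \<Rightarrow> real^'n \<Rightarrow> bool" where
  "touches_above \<phi> u x \<longleftrightarrow>
     \<phi> \<in> C2 \<and> u x = \<phi> x \<and> (\<forall>y. u y - \<phi> y \<le> u x - \<phi> x)"

definition touches_below :: "(real^'n \<Rightarrow> real) \<Rightarrow> (real^'n \<Rightarrow> real) \<Rightarrow> real^'n \<Rightarrow> bool" where
  "touches_below \<phi> v x \<longleftrightarrow>
     \<phi> \<in> C2 \<and> v x = \<phi> x \<and> (\<forall>y. v x - \<phi> x \<le> v y - \<phi> y)"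

definition levy_integrand ::
    "(real^'n \<Rightarrow> real) \<Rightarrow> real^'n \<Rightarrow> real^'n \<Rightarrow> real^'n \<Rightarrow> real" where
  "levy_integrand w p x z = w (x + z) - w x - indicat_real {z. norm z \<le> 1} z * (z \<bullet> p)"

text \<open>A \<open>C\<^sup>2\<close> test function may grow arbitrarily fast, so the integral of its Levy
  integrand can diverge at infinity. It is therefore taken in the extended sense, and is
  meaningful when not both the positive and the negative part have infinite integral
  (Isabelle's Bochner integral would silently return \<open>0\<close> for divergent integrals).\<close>

definition has_ext_integral :: "'a measure \<Rightarrow> ('a \<Rightarrow> real) \<Rightarrow> bool" where
  "has_ext_integral M g \<longleftrightarrow> g \<in> borel_measurable M \<and>
     ((\<integral>\<^sup>+z. ennreal (g z) \<partial>M) < \<infinity> \<or> (\<integral>\<^sup>+z. ennreal (- g z) \<partial>M) < \<infinity>)"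

definition ext_integral :: "'a measure \<Rightarrow> ('a \<Rightarrow> real) \<Rightarrow> ereal" where
  "ext_integral M g =
     enn2ereal (\<integral>\<^sup>+z. ennreal (g z) \<partial>M) - enn2ereal (\<integral>\<^sup>+z. ennreal (- g z) \<partial>M)"

text \<open>In the B notions the test function itself is integrated. The inequality is imposed
  for every test function, with the integral in the extended sense.

  They presuppose that the nonlocal term makes sense at the points where it is
  tested: at a point admitting test functions, at least one of them must have a finite
  integral. This is the second conjunct under the quantifiers. Without it every \<open>u\<close> that
  grows so fast that \<open>\<integral> \<phi>(x + z) q(z) dz = +\<infinity>\<close> for all \<open>\<phi> \<ge> u\<close> would
  be a subsolution for all \<open>F\<close>, because the inequality would read \<open>-\<infinity> \<le> 0\<close>.
  Demanding a finite integral for every test function would be too much: unless \<open>q\<close>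
  decays fast, even \<open>u = 0\<close> is touched by test functions with infinite integral.\<close>

definition viscosity_subsolution_B ::
    "(real^'n) set \<Rightarrow> (real^'n \<Rightarrow> real \<Rightarrow> real^'n \<Rightarrow> real^'n^'n \<Rightarrow> real) \<Rightarrow> (real^'n \<Rightarrow> real) \<Rightarrow>
     (real^'n \<Rightarrow> real) \<Rightarrow> bool" where
  "viscosity_subsolution_B \<Omega> F q u \<longleftrightarrow> u \<in> USC \<and>
     (\<forall>x\<in>\<Omega>. \<forall>\<phi>. touches_above \<phi> u x \<longrightarrow>
        has_ext_integral (levy_measure q) (levy_integrand \<phi> (grad \<phi> x) x) \<and>
        (\<exists>\<psi>. touches_above \<psi> u x \<and>
             integrable (levy_measure q) (levy_integrand \<psi> (grad \<psi> x) x)) \<and>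
        ereal (F x (u x) (grad \<phi> x) (hessian \<phi> x))
          - ext_integral (levy_measure q) (levy_integrand \<phi> (grad \<phi> x) x) \<le> 0)"

definition viscosity_supersolution_B ::
    "(real^'n) set \<Rightarrow> (real^'n \<Rightarrow> real \<Rightarrow> real^'n \<Rightarrow> real^'n^'n \<Rightarrow> real) \<Rightarrow> (real^'n \<Rightarrow> real) \<Rightarrow>
     (real^'n \<Rightarrow> real) \<Rightarrow> bool" where
  "viscosity_supersolution_B \<Omega> F q v \<longleftrightarrow> v \<in> LSC \<and>
     (\<forall>x\<in>\<Omega>. \<forall>\<phi>. touches_below \<phi> v x \<longrightarrow>
        has_ext_integral (levy_measure q) (levy_integrand \<phi> (grad \<phi> x) x) \<and>
        (\<exists>\<psi>. touches_below \<psi> v x \<and>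
             integrable (levy_measure q) (levy_integrand \<psi> (grad \<psi> x) x)) \<and>
        ereal (F x (v x) (grad \<phi> x) (hessian \<phi> x))
          - ext_integral (levy_measure q) (levy_integrand \<phi> (grad \<phi> x) x) \<ge> 0)"

text \<open>In the C notions the solution is integrated, and only the gradient in the compensator
  comes from the test function.\<close>

definition viscosity_subsolution_C ::
    "(real^'n) set \<Rightarrow> (real^'n \<Rightarrow> real \<Rightarrow> real^'n \<Rightarrow> real^'n^'n \<Rightarrow> real) \<Rightarrow> (real^'n \<Rightarrow> real) \<Rightarrow>
     (real^'n \<Rightarrow> real) \<Rightarrow> bool" where
  "viscosity_subsolution_C \<Omega> F q u \<longleftrightarrow> u \<in> USC \<and>
     (\<forall>x\<in>\<Omega>. \<forall>\<phi>. touches_above \<phi> u x \<longrightarrow>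
        integrable (levy_measure q) (levy_integrand u (grad \<phi> x) x) \<and>
        F x (u x) (grad \<phi> x) (hessian \<phi> x)
          - (\<integral>z. levy_integrand u (grad \<phi> x) x z \<partial>levy_measure q) \<le> 0)"

definition viscosity_supersolution_C ::
    "(real^'n) set \<Rightarrow> (real^'n \<Rightarrow> real \<Rightarrow> real^'n \<Rightarrow> real^'n^'n \<Rightarrow> real) \<Rightarrow> (real^'n \<Rightarrow> real) \<Rightarrow>
     (real^'n \<Rightarrow> real) \<Rightarrow> bool" where
  "viscosity_supersolution_C \<Omega> F q v \<longleftrightarrow> v \<in> LSC \<and>
     (\<forall>x\<in>\<Omega>. \<forall>\<phi>. touches_below \<phi> v x \<longrightarrow>
        integrable (levy_measure q) (levy_integrand v (grad \<phi> x) x) \<and>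
        F x (v x) (grad \<phi> x) (hessian \<phi> x)
          - (\<integral>z. levy_integrand v (grad \<phi> x) x z \<partial>levy_measure q) \<ge> 0)"

end

theory Submission
  imports Defs
begin

text \<open>Write \<open>w = \<phi> - u \<ge> 0\<close> for a test function \<open>\<phi>\<close> that touches the subsolution \<open>u\<close> from above at
  \<open>x\<close>.  The nonlocal terms of \<open>\<phi>\<close> and \<open>u\<close>, with the same gradient in the compensator, differ by the
  integral of \<open>w (x + z)\<close>.  The function \<open>w\<close> is lower semicontinuous, so its integral over an open
  set is the supremum of the integrals of the \<open>C\<^sup>2\<close> functions \<open>g\<close> with \<open>0 \<le> g \<le> w\<close> and compact
  support in that set (\<open>nn_integral_le_of_C2_minorants\<close>); and \<open>\<phi> - g\<close> is again a test function, with
  unchanged derivatives at \<open>x\<close> if \<open>g\<close> vanishes near \<open>x\<close>.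

  From B to C: if \<open>\<phi>\<close> has a finite nonlocal term, the inequality for the test functions \<open>\<phi> - g\<close>
  bounds the integral of every \<open>g\<close>, hence that of \<open>w\<close>, and the bound is the inequality for \<open>u\<close>
  (\<open>nonlocal_bound_passes_to_subsolution\<close>).  A general \<open>\<phi>\<close> is first modified away from \<open>x\<close>, by
  gluing it to a test function whose nonlocal term is finite (\<open>touching_function_gluing\<close>).

  From C to B: since \<open>u \<le> \<phi>\<close>, the extended integral of \<open>\<phi>\<close> exists and dominates that of \<open>u\<close>, which
  gives the inequality.  A test function with finite nonlocal term is \<open>\<phi> - g\<close>, where \<open>g\<close> is assembled
  on annuli around \<open>x\<close> from minorants of \<open>w\<close> such that \<open>w - g\<close> has finite integral away from \<open>x\<close>
  (\<open>integrable_touching_function\<close>).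

  Supersolutions are subsolutions after the reflection \<open>v \<mapsto> - v\<close>,
  \<open>F (x, r, p, X) \<mapsto> - F (x, - r, - p, - X)\<close>.\<close>

section \<open>Calculus of twice continuously differentiable functions\<close>

text \<open>The vector field \<open>D\<close> is the gradient of \<open>f\<close>, and \<open>H\<close>, which is continuous, is the derivative of
  \<open>D\<close>.  Closure properties of \<open>C2\<close> are proved on explicit witnesses \<open>D\<close> and \<open>H\<close>.\<close>

definition has_grad_hess ::
    "(real^'n \<Rightarrow> real) \<Rightarrow> (real^'n \<Rightarrow> real^'n) \<Rightarrow> (real^'n \<Rightarrow> real^'n^'n) \<Rightarrow> bool" where
  "has_grad_hess f D H \<longleftrightarrow>
     (\<forall>x. GDERIV f x :> D x) \<and>
     (\<forall>x. (D has_derivative (\<lambda>h. H x *v h)) (at x)) \<and> continuous_on UNIV H"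

lemma grad_eqI: "GDERIV f x :> D \<Longrightarrow> grad f x = D"
  for f :: "real^'n \<Rightarrow> real"
  unfolding grad_def
proof (rule the_equality)
  fix E assume a: "GDERIV f x :> D" "GDERIV f x :> E"
  hence "(\<lambda>h. h \<bullet> D) = (\<lambda>h. h \<bullet> E)"
    unfolding gderiv_def by (rule has_derivative_unique)
  thus "E = D" by (metis vector_eq_ldot)
qed

lemma GDERIV_grad:
  fixes f :: "real^'n \<Rightarrow> real"
  assumes "f differentiable (at x)"
  shows "GDERIV f x :> grad f x"
proof -
  obtain f' where f': "(f has_derivative f') (at x)"
    using assms by (auto simp: differentiable_def)
  have "linear f'" using f' by (rule has_derivative_linear)
  hence "f' = (\<lambda>h. h \<bullet> adjoint f' 1)"
    using adjoint_works[of f' _ "1::real"] by auto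
  hence "GDERIV f x :> adjoint f' 1"
    using f' unfolding gderiv_def by metis
  thus ?thesis using grad_eqI by metis
qed

lemma has_grad_hessD:
  assumes "has_grad_hess f D H"
  shows "f \<in> C2" "grad f = D" "hessian f = H"
proof -
  show g: "grad f = D"
    using assms by (auto simp: has_grad_hess_def intro!: grad_eqI)
  have "hessian f x = H x" for x
  proof -
    have "(D has_derivative (\<lambda>h. H x *v h)) (at x)"
      using assms by (auto simp: has_grad_hess_def)
    from frechet_derivative_at[OF this] show ?thesis
      unfolding hessian_def g jacobian_def by (metis matrix_of_matrix_vector_mul)
  qed
  thus h: "hessian f = H" by auto
  show "f \<in> C2"
    using assms unfolding C2_def has_grad_hess_def gderiv_def
    by (auto simp: g h differentiable_def)
qed

lemma C2_has_grad_hess: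
  assumes "f \<in> C2"
  shows "has_grad_hess f (grad f) (hessian f)"
  using assms unfolding C2_def has_grad_hess_def hessian_def
  by (auto simp: GDERIV_grad jacobian_works[symmetric])

lemma C2_continuous: "f \<in> C2 \<Longrightarrow> continuous_on A f"
  unfolding C2_def
  by (auto intro: differentiable_imp_continuous_on differentiable_at_imp_differentiable_on)

lemma C2_borel: "f \<in> C2 \<Longrightarrow> f \<in> borel_measurable borel"
  by (rule borel_measurable_continuous_onI) (rule C2_continuous)

text \<open>The matrix \<open>a b\<^sup>T\<close>, which occurs in the Hessian of products and compositions.\<close>

definition outer :: "real^'n \<Rightarrow> real^'n \<Rightarrow> real^'n^'n" where
  "outer a b = (\<chi> i j. a $ i * b $ j)"

lemma outer_mult: "outer a b *v h = (b \<bullet> h) *\<^sub>R a"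
  by (simp add: outer_def matrix_vector_mult_def vec_eq_iff inner_vec_def sum_distrib_left
      mult_ac)

lemma continuous_on_outer [continuous_intros]:
  "continuous_on S f \<Longrightarrow> continuous_on S g \<Longrightarrow> continuous_on S (\<lambda>x. outer (f x) (g x))"
  unfolding outer_def by (intro continuous_intros)

lemma has_grad_hess_continuous:
  assumes "has_grad_hess f D H"
  shows "continuous_on UNIV f" "continuous_on UNIV D" "continuous_on UNIV H"
  using assms unfolding has_grad_hess_def gderiv_def
  by (blast intro: continuous_at_imp_continuous_on has_derivative_continuous)+

lemma has_grad_hess_const: "has_grad_hess (\<lambda>x. c) (\<lambda>x. 0) (\<lambda>x. 0)"
  unfolding has_grad_hess_def
  by (auto simp: GDERIV_const fun_eq_iff intro!: continuous_intros
      intro: has_derivative_eq_rhs[OF has_derivative_const])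

lemma has_grad_hess_add:
  assumes "has_grad_hess f D H" "has_grad_hess g E K"
  shows "has_grad_hess (\<lambda>x. f x + g x) (\<lambda>x. D x + E x) (\<lambda>x. H x + K x)"
  using assms unfolding has_grad_hess_def
  by (auto simp: matrix_vector_mult_add_rdistrib fun_eq_iff
      intro!: GDERIV_add continuous_intros intro: has_derivative_eq_rhs[OF has_derivative_add])

lemma has_grad_hess_mult:
  assumes "has_grad_hess f D H" "has_grad_hess g E K"
  shows "has_grad_hess (\<lambda>x. f x * g x) (\<lambda>x. f x *\<^sub>R E x + g x *\<^sub>R D x)
     (\<lambda>x. f x *\<^sub>R K x + outer (E x) (D x) + (g x *\<^sub>R H x + outer (D x) (E x)))"
  unfolding has_grad_hess_def
proof (intro conjI allI)
  fix x
  have f: "GDERIV f x :> D x" "(D has_derivative (\<lambda>h. H x *v h)) (at x)"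
    and g: "GDERIV g x :> E x" "(E has_derivative (\<lambda>h. K x *v h)) (at x)"
    using assms by (auto simp: has_grad_hess_def)
  show "GDERIV (\<lambda>x. f x * g x) x :> f x *\<^sub>R E x + g x *\<^sub>R D x"
    by (rule GDERIV_mult f g)+
  show "((\<lambda>x. f x *\<^sub>R E x + g x *\<^sub>R D x) has_derivative
      (\<lambda>h. (f x *\<^sub>R K x + outer (E x) (D x) + (g x *\<^sub>R H x + outer (D x) (E x))) *v h)) (at x)"
    using f g unfolding gderiv_def
    by (auto intro!: derivative_eq_intros
        simp: matrix_vector_mult_add_rdistrib outer_mult scaleR_matrix_vector_assoc inner_commute)
next
  show "continuous_on UNIV
      (\<lambda>x. f x *\<^sub>R K x + outer (E x) (D x) + (g x *\<^sub>R H x + outer (D x) (E x)))"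
    by (intro continuous_intros has_grad_hess_continuous[OF assms(1)]
        has_grad_hess_continuous[OF assms(2)])
qed

lemma has_grad_hess_compose:
  assumes f: "has_grad_hess f D H"
    and P: "\<And>t. (P has_real_derivative P' t) (at t)" "\<And>t. (P' has_real_derivative P'' t) (at t)"
    and cont: "continuous_on UNIV P''"
  shows "has_grad_hess (\<lambda>x. P (f x)) (\<lambda>x. P' (f x) *\<^sub>R D x)
     (\<lambda>x. P' (f x) *\<^sub>R H x + P'' (f x) *\<^sub>R outer (D x) (D x))"
  unfolding has_grad_hess_def
proof (intro conjI allI)
  fix x
  have g: "GDERIV f x :> D x" and h: "(D has_derivative (\<lambda>h. H x *v h)) (at x)"
    using f by (auto simp: has_grad_hess_def)
  show "GDERIV (\<lambda>x. P (f x)) x :> P' (f x) *\<^sub>R D x"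
    by (rule GDERIV_DERIV_compose[OF g P(1)])
  have *: "GDERIV (\<lambda>x. P' (f x)) x :> P'' (f x) *\<^sub>R D x"
    by (rule GDERIV_DERIV_compose[OF g P(2)])
  show "((\<lambda>x. P' (f x) *\<^sub>R D x) has_derivative
      (\<lambda>h. (P' (f x) *\<^sub>R H x + P'' (f x) *\<^sub>R outer (D x) (D x)) *v h)) (at x)"
    using h * unfolding gderiv_def
    by (auto intro!: derivative_eq_intros
        simp: matrix_vector_mult_add_rdistrib outer_mult inner_commute
          scaleR_matrix_vector_assoc[symmetric])
next
  have "continuous_on UNIV P'" using P(2)
    by (auto intro!: DERIV_continuous_on intro: has_field_derivative_at_within)
  from continuous_on_compose2[OF this] continuous_on_compose2[OF cont]
  show "continuous_on UNIV
      (\<lambda>x. P' (f x) *\<^sub>R H x + P'' (f x) *\<^sub>R outer (D x) (D x))"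
    by (intro continuous_intros has_grad_hess_continuous[OF f]) 
       (auto intro: has_grad_hess_continuous[OF f] continuous_on_compose2[OF cont])
qed

lemma C2_const: "(\<lambda>x. c) \<in> C2"
  using has_grad_hess_const has_grad_hessD(1) by blast

lemma C2_add: "f \<in> C2 \<Longrightarrow> g \<in> C2 \<Longrightarrow> (\<lambda>x. f x + g x) \<in> C2"
  by (blast dest: C2_has_grad_hess intro: has_grad_hess_add has_grad_hessD(1))

lemma C2_mult: "f \<in> C2 \<Longrightarrow> g \<in> C2 \<Longrightarrow> (\<lambda>x. f x * g x) \<in> C2"
  by (blast dest: C2_has_grad_hess intro: has_grad_hess_mult has_grad_hessD(1))

lemma has_grad_hess_minus:
  assumes "has_grad_hess f D H"
  shows "has_grad_hess (\<lambda>x. - f x) (\<lambda>x. - D x) (\<lambda>x. - H x)"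
proof -
  have [simp]: "(*v) (- A) = (\<lambda>h. - (A *v h))" for A :: "real^'n^'n"
    by (simp add: matrix_vector_mult_def vec_eq_iff sum_negf fun_eq_iff)
  show ?thesis
    using assms unfolding has_grad_hess_def
    by (auto intro!: GDERIV_minus continuous_intros has_derivative_minus)
qed

lemma C2_minus: "f \<in> C2 \<Longrightarrow> (\<lambda>x. - f x) \<in> C2"
  by (blast dest: C2_has_grad_hess intro: has_grad_hess_minus has_grad_hessD(1))

lemma C2_diff: "f \<in> C2 \<Longrightarrow> g \<in> C2 \<Longrightarrow> (\<lambda>x. f x - g x) \<in> C2"
  using C2_add[OF _ C2_minus, of f g] by simp

lemma C2_sum: "(\<And>i. i \<in> I \<Longrightarrow> f i \<in> C2) \<Longrightarrow> (\<lambda>x. \<Sum>i\<in>I. f i x) \<in> C2"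
  by (induction I rule: infinite_finite_induct) (auto intro: C2_const C2_add)

lemma C2_prod: "(\<And>i. i \<in> I \<Longrightarrow> f i \<in> C2) \<Longrightarrow> (\<lambda>x. \<Prod>i\<in>I. f i x) \<in> C2"
  by (induction I rule: infinite_finite_induct) (auto intro: C2_const C2_mult)

lemma C2_dist_square: "(\<lambda>y. (norm (y - c))\<^sup>2) \<in> C2"
proof -
  have "has_grad_hess (\<lambda>y. (norm (y - c))\<^sup>2) (\<lambda>y. 2 *\<^sub>R (y - c)) (\<lambda>y. 2 *\<^sub>R mat 1)"
    unfolding has_grad_hess_def gderiv_def power2_norm_eq_inner
    by (auto intro!: derivative_eq_intros continuous_intros
        simp: inner_commute scaleR_matrix_vector_assoc[symmetric])
  thus ?thesis by (rule has_grad_hessD)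
qed

text \<open>The cube of the positive part is \<open>C\<^sup>2\<close>; every cutoff function below is built from it.\<close>

lemma pos_part_power_deriv:
  "((\<lambda>t::real. max 0 t ^ Suc (Suc n)) has_real_derivative real (n + 2) * max 0 t ^ Suc n) (at t)"
proof (cases "t = 0")
  case True
  have "((\<lambda>h. (max 0 h ^ Suc (Suc n)) / h) \<longlongrightarrow> 0) (at (0::real))"
  proof (rule Lim_null_comparison)
    have "norm (max 0 h ^ Suc (Suc n) / h) \<le> \<bar>h\<bar> ^ Suc n" for h :: real
    proof (cases "h > 0")
      case False
      hence "max 0 h = 0" by simp
      hence "norm (max 0 h ^ Suc (Suc n) / h) = 0" by simp
      also have "0 \<le> \<bar>h\<bar> ^ Suc n" by (rule zero_le_power) simp
      finally show ?thesis .
    qed auto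
    thus "\<forall>\<^sub>F h in at (0::real). norm (max 0 h ^ Suc (Suc n) / h) \<le> \<bar>h\<bar> ^ Suc n"
      by simp
    have "((\<lambda>h::real. \<bar>h\<bar> ^ Suc n) \<longlongrightarrow> \<bar>0\<bar> ^ Suc n) (at 0)"
      by (intro tendsto_intros)
    thus "((\<lambda>h::real. \<bar>h\<bar> ^ Suc n) \<longlongrightarrow> 0) (at 0)" by simp
  qed
  thus ?thesis using True by (simp add: DERIV_def)
next
  case False
  show ?thesis
  proof (cases "t > 0")
    case True
    have "((\<lambda>t::real. t ^ Suc (Suc n)) has_real_derivative real (n + 2) * t ^ Suc n) (at t)"
      using DERIV_pow[of "Suc (Suc n)" t] by simp
    hence "((\<lambda>t::real. max 0 t ^ Suc (Suc n)) has_real_derivative real (n + 2) * t ^ Suc n) (at t)"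
      by (rule has_field_derivative_transform_within_open[of _ _ _ "{0<..}"])
         (use True in auto)
    thus ?thesis using True by simp
  next
    case False
    have "((\<lambda>t::real. 0) has_real_derivative 0) (at t)" by simp
    hence "((\<lambda>t::real. max 0 t ^ Suc (Suc n)) has_real_derivative 0) (at t)"
      by (rule has_field_derivative_transform_within_open[of _ _ _ "{..<0}"])
         (use False \<open>t \<noteq> 0\<close> in auto)
    thus ?thesis using False by simp
  qed
qed

lemma C2_pos_part_cube:
  assumes "f \<in> C2"
  shows "(\<lambda>x. max 0 (f x) ^ 3) \<in> C2"
proof -
  have 1: "((\<lambda>t::real. max 0 t ^ 3) has_real_derivative 3 * max 0 t ^ 2) (at t)" for t
    using pos_part_power_deriv[of 1 t] by (simp add: numeral_eq_Suc)
  have 2: "((\<lambda>t::real. 3 * max 0 t ^ 2) has_real_derivative 6 * max 0 t) (at t)" for t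
    using DERIV_cmult[OF pos_part_power_deriv[of 0 t], of 3] by (simp add: numeral_eq_Suc)
  have 3: "continuous_on UNIV (\<lambda>t::real. 6 * max 0 t)" by (intro continuous_intros)
  from has_grad_hess_compose[OF C2_has_grad_hess[OF assms] 1 2 3]
  show ?thesis by (rule has_grad_hessD)
qed

lemma has_derivative_cong_nhds:
  fixes f g :: "'a::real_normed_vector \<Rightarrow> 'b::real_normed_vector"
  assumes "\<forall>\<^sub>F y in nhds x. f y = g y"
  shows "(f has_derivative f') (at x) \<longleftrightarrow> (g has_derivative f') (at x)"
proof -
  have "f x = g x" using eventually_nhds_x_imp_x[OF assms] .
  moreover have "\<forall>\<^sub>F y in at x. f y = g y"
    using assms by (auto simp: eventually_at_filter elim: eventually_mono)
  ultimately show ?thesis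
    by (auto elim!: has_derivative_transform_eventually eventually_mono)
qed

lemma grad_cong:
  fixes f g :: "real^'n \<Rightarrow> real"
  assumes "\<forall>\<^sub>F y in nhds x. f y = g y"
  shows "grad f x = grad g x"
  unfolding grad_def gderiv_def using has_derivative_cong_nhds[OF assms] by simp

lemma eventually_grad_cong:
  fixes f g :: "real^'n \<Rightarrow> real"
  assumes "\<forall>\<^sub>F y in nhds x. f y = g y"
  shows "\<forall>\<^sub>F y in nhds x. grad f y = grad g y"
proof -
  have "\<forall>\<^sub>F y in nhds x. \<forall>\<^sub>F y' in nhds y. f y' = g y'"
    using assms by (simp add: eventually_eventually)
  thus ?thesis by (rule eventually_mono) (rule grad_cong)
qed

lemma hessian_cong:
  fixes f g :: "real^'n \<Rightarrow> real"
  assumes "\<forall>\<^sub>F y in nhds x. f y = g y"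
  shows "hessian f x = hessian g x"
  unfolding hessian_def jacobian_def frechet_derivative_def
  using has_derivative_cong_nhds[OF eventually_grad_cong[OF assms]] by simp

lemma C2_local:
  fixes f :: "real^'n \<Rightarrow> real"
  assumes "\<And>x. \<exists>g\<in>C2. \<forall>\<^sub>F y in nhds x. f y = g y"
  shows "f \<in> C2"
proof -
  have "f differentiable (at x) \<and> grad f differentiable (at x) \<and> isCont (hessian f) x" for x
  proof -
    obtain g where g: "g \<in> C2" and ev: "\<forall>\<^sub>F y in nhds x. f y = g y" using assms by blast
    have "\<forall>\<^sub>F y in nhds x. \<forall>\<^sub>F y' in nhds y. f y' = g y'"
      using ev by (simp add: eventually_eventually)
    hence "\<forall>\<^sub>F y in nhds x. hessian f y = hessian g y"
      by (rule eventually_mono) (rule hessian_cong)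
    from isCont_cong[OF this] g have "isCont (hessian f) x"
      by (auto simp: C2_def continuous_on_eq_continuous_at)
    moreover have "f differentiable (at x)" "grad f differentiable (at x)"
      using g has_derivative_cong_nhds[OF ev] has_derivative_cong_nhds[OF eventually_grad_cong[OF ev]]
      by (auto simp: C2_def differentiable_def)
    ultimately show ?thesis by blast
  qed
  thus ?thesis unfolding C2_def by (auto simp: continuous_on_eq_continuous_at)
qed

text \<open>A cutoff function that vanishes on the ball of half the radius and is \<open>1\<close> outside the ball.\<close>

lemma C2_cutoff:
  fixes c :: "real^'n"
  assumes "r > 0"
  obtains \<kappa> where "\<kappa> \<in> C2" "\<And>y. 0 \<le> \<kappa> y" "\<And>y. \<kappa> y \<le> 1"
    "\<And>y. norm (y - c) \<le> r / 2 \<Longrightarrow> \<kappa> y = 0" "\<And>y. r \<le> norm (y - c) \<Longrightarrow> \<kappa> y = 1"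
proof -
  define P where "P t = max 0 t ^ 3" for t :: real
  have P: "0 \<le> P t" "t \<le> 0 \<Longrightarrow> P t = 0" "t \<le> 1 \<Longrightarrow> P t \<le> 1" for t
    by (auto simp: P_def power_le_one)
  have P_mono: "P s \<le> P t" if "s \<le> t" for s t
    using that by (auto simp: P_def intro!: power_mono)
  define a where "a = P (r\<^sup>2 - (r/2)\<^sup>2)"
  have "(r/2)\<^sup>2 < r\<^sup>2" using assms by (intro power_strict_mono) auto
  hence a: "a > 0" by (auto simp: a_def P_def)
  define \<kappa> where "\<kappa> y = 1 - P (1 - 1 / a * P ((norm (y - c))\<^sup>2 - (r/2)\<^sup>2))" for y
  show thesis
  proof
    show "\<kappa> \<in> C2" unfolding \<kappa>_def[abs_def] P_def
      by (intro C2_diff C2_const C2_pos_part_cube C2_mult C2_dist_square)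
    fix y
    show "0 \<le> \<kappa> y" "\<kappa> y \<le> 1"
      using P a by (auto simp: \<kappa>_def)
    {
      assume "norm (y - c) \<le> r / 2"
      hence "(norm (y - c))\<^sup>2 \<le> (r/2)\<^sup>2" by (intro power_mono) auto
      hence "P ((norm (y - c))\<^sup>2 - (r/2)\<^sup>2) = 0" by (intro P) simp
      thus "\<kappa> y = 0" unfolding \<kappa>_def by (simp add: P_def)
    next
      assume "r \<le> norm (y - c)"
      hence "r\<^sup>2 \<le> (norm (y - c))\<^sup>2" using assms by (intro power_mono) auto
      hence "a \<le> P ((norm (y - c))\<^sup>2 - (r/2)\<^sup>2)" unfolding a_def by (intro P_mono) simp
      thus "\<kappa> y = 1" using a P(2) by (simp add: \<kappa>_def)
    }
  qed
qed

text \<open>A bump function between a compact set and an open set.  It is \<open>1 - \<Prod> \<kappa>\<close>, where the \<open>\<kappa>\<close>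
  are cutoff functions of finitely many balls that cover \<open>K\<close> after halving their radii.\<close>

lemma C2_bump:
  fixes K V :: "(real^'n) set"
  assumes "compact K" "open V" "K \<subseteq> V"
  obtains \<beta> L where "\<beta> \<in> C2" "\<And>y. 0 \<le> \<beta> y" "\<And>y. \<beta> y \<le> 1" "\<And>y. y \<in> K \<Longrightarrow> \<beta> y = 1"
    "compact L" "L \<subseteq> V" "\<And>y. y \<notin> L \<Longrightarrow> \<beta> y = 0"
proof -
  have "\<exists>r>0. cball c r \<subseteq> V" if "c \<in> K" for c
    using assms that by (meson open_contains_cball subsetD)
  then obtain r where r: "\<And>c. c \<in> K \<Longrightarrow> r c > 0" "\<And>c. c \<in> K \<Longrightarrow> cball c (r c) \<subseteq> V"
    by metis
  define Q where "Q c \<kappa> \<longleftrightarrow> \<kappa> \<in> C2 \<and> (\<forall>y. 0 \<le> \<kappa> y \<and> \<kappa> y \<le> 1) \<and>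
      (\<forall>y. norm (y - c) \<le> r c / 2 \<longrightarrow> \<kappa> y = 0) \<and> (\<forall>y. r c \<le> norm (y - c) \<longrightarrow> \<kappa> y = 1)"
    for c \<kappa>
  have "\<exists>\<kappa>. Q c \<kappa>" if "c \<in> K" for c
    by (rule C2_cutoff[OF r(1)[OF that], of c]) (auto simp: Q_def)
  then obtain \<kappa> where "\<And>c. c \<in> K \<Longrightarrow> Q c (\<kappa> c)"
    by metis
  hence \<kappa>: "\<And>c. c \<in> K \<Longrightarrow> \<kappa> c \<in> C2"
    "\<And>c y. c \<in> K \<Longrightarrow> 0 \<le> \<kappa> c y" "\<And>c y. c \<in> K \<Longrightarrow> \<kappa> c y \<le> 1"
    "\<And>c y. c \<in> K \<Longrightarrow> norm (y - c) \<le> r c / 2 \<Longrightarrow> \<kappa> c y = 0"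
    "\<And>c y. c \<in> K \<Longrightarrow> r c \<le> norm (y - c) \<Longrightarrow> \<kappa> c y = 1"
    by (auto simp: Q_def)
  have "K \<subseteq> (\<Union>c\<in>K. ball c (r c / 2))" using r(1) by fastforce
  then obtain C where C: "C \<subseteq> K" "finite C" "K \<subseteq> (\<Union>c\<in>C. ball c (r c / 2))"
    by (rule compactE_image[OF assms(1), rotated]) auto
  show thesis
  proof (rule that[of "\<lambda>y. 1 - (\<Prod>c\<in>C. \<kappa> c y)" "\<Union>c\<in>C. cball c (r c)"])
    show "(\<lambda>y. 1 - (\<Prod>c\<in>C. \<kappa> c y)) \<in> C2"
      using C(1) by (intro C2_diff C2_const C2_prod \<kappa>) auto
    show "compact (\<Union>c\<in>C. cball c (r c))" using C by auto
    show "(\<Union>c\<in>C. cball c (r c)) \<subseteq> V" using C r by blast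
    fix y
    show "0 \<le> 1 - (\<Prod>c\<in>C. \<kappa> c y)" using C \<kappa>(2,3) by (auto intro!: prod_le_1)
    show "1 - (\<Prod>c\<in>C. \<kappa> c y) \<le> 1" using C \<kappa>(2,3) by (auto intro!: prod_nonneg)
    show "1 - (\<Prod>c\<in>C. \<kappa> c y) = 1" if "y \<in> K"
    proof -
      obtain c where "c \<in> C" "y \<in> ball c (r c / 2)" using \<open>y \<in> K\<close> C(3) by blast
      hence c: "c \<in> C" "norm (y - c) < r c / 2" by (auto simp: dist_norm norm_minus_commute)
      hence "\<kappa> c y = 0" using C(1) by (auto intro!: \<kappa>(4))
      thus ?thesis using c(1) C(2) by (auto intro!: prod_zero)
    qed
    show "1 - (\<Prod>c\<in>C. \<kappa> c y) = 0" if "y \<notin> (\<Union>c\<in>C. cball c (r c))"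
    proof -
      have "\<kappa> c y = 1" if "c \<in> C" for c
        using C(1) that \<open>y \<notin> _\<close> by (intro \<kappa>(5)) (auto simp: dist_norm norm_minus_commute)
      thus ?thesis by simp
    qed
  qed
qed

section \<open>Approximation of lower semicontinuous functions from below\<close>

lemma C2_approx_indicator:
  fixes V :: "(real^'n) set"
  assumes "open V"
  obtains \<beta> :: "nat \<Rightarrow> real^'n \<Rightarrow> real" where
    "\<And>m. \<beta> m \<in> C2" "\<And>m y. 0 \<le> \<beta> m y" "\<And>m y. \<beta> m y \<le> indicator V y"
    "\<And>m. \<exists>L. compact L \<and> L \<subseteq> V \<and> (\<forall>y. y \<notin> L \<longrightarrow> \<beta> m y = 0)"
    "\<And>y. (\<lambda>m. \<beta> m y) \<longlonglongrightarrow> indicator V y"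
proof -
  obtain C :: "nat \<Rightarrow> (real^'n) set" where C: "\<And>m. compact (C m)" "\<And>m. C m \<subseteq> V"
    "\<And>m. C m \<subseteq> interior (C (Suc m))" "\<Union>(range C) = V"
    by (rule open_Union_compact_subsets[OF assms]) blast
  have "incseq C" using C(3) interior_subset by (intro incseq_SucI) blast
  define Q where "Q m \<beta> \<longleftrightarrow> \<beta> \<in> C2 \<and> (\<forall>y. 0 \<le> \<beta> y) \<and> (\<forall>y. \<beta> y \<le> 1) \<and> (\<forall>y\<in>C m. \<beta> y = 1) \<and>
     (\<exists>L. compact L \<and> L \<subseteq> V \<and> (\<forall>y. y \<notin> L \<longrightarrow> \<beta> y = 0))" for m \<beta>
  have "\<exists>\<beta>. Q m \<beta>" for m
    by (rule C2_bump[OF C(1) assms C(2), of m]) (auto simp: Q_def)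
  then obtain \<beta> where "\<And>m. Q m (\<beta> m)" by metis
  hence \<beta>: "\<beta> m \<in> C2" "0 \<le> \<beta> m y" "\<beta> m y \<le> 1" "y \<in> C m \<Longrightarrow> \<beta> m y = 1"
     "\<exists>L. compact L \<and> L \<subseteq> V \<and> (\<forall>y. y \<notin> L \<longrightarrow> \<beta> m y = 0)" for m y
    by (auto simp: Q_def)
  have zero: "\<beta> m y = 0" if "y \<notin> V" for m y
    using \<beta>(5)[of m] that by blast
  show thesis
  proof (rule that[of \<beta>])
    show "\<beta> m y \<le> indicator V y" for m y
      using \<beta>(3)[of m y] zero[of y m] by (cases "y \<in> V") auto
    show "(\<lambda>m. \<beta> m y) \<longlonglongrightarrow> indicator V y" for y
    proof (cases "y \<in> V")
      case True
      then obtain k where "y \<in> C k" using C(4) by blast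
      hence "\<beta> m y = indicator V y" if "m \<ge> k" for m
        using incseqD[OF \<open>incseq C\<close> that] True \<beta>(4)[of y m] by auto
      thus ?thesis by (intro tendsto_eventually eventually_sequentiallyI[of k])
    next
      case False thus ?thesis using zero by simp
    qed
  qed (use \<beta> in auto)
qed

lemma nn_integral_limit_le:
  fixes f :: "nat \<Rightarrow> 'a \<Rightarrow> ennreal"
  assumes meas: "\<And>m. f m \<in> borel_measurable M"
    and lim: "\<And>y. (\<lambda>m. f m y) \<longlonglongrightarrow> h y" and bound: "\<And>m. (\<integral>\<^sup>+y. f m y \<partial>M) \<le> C"
  shows "(\<integral>\<^sup>+y. h y \<partial>M) \<le> C"
proof -
  have "h y = liminf (\<lambda>m. f m y)" for y
    using lim_imp_Liminf[OF _ lim] by simp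
  hence "(\<integral>\<^sup>+y. h y \<partial>M) = (\<integral>\<^sup>+y. liminf (\<lambda>m. f m y) \<partial>M)" by simp
  also have "\<dots> \<le> liminf (\<lambda>m. \<integral>\<^sup>+y. f m y \<partial>M)"
    using meas by (rule nn_integral_liminf)
  also have "\<dots> \<le> limsup (\<lambda>m. \<integral>\<^sup>+y. f m y \<partial>M)" by (intro Liminf_le_Limsup) simp
  also have "\<dots> \<le> C" using bound by (intro Limsup_bounded) simp
  finally show ?thesis .
qed

text \<open>A nonnegative number is the sum of its layers of height \<open>e\<close>, up to an error \<open>e\<close> and a
  truncation at height \<open>n e\<close>.\<close>

lemma layer_sum:
  fixes a e :: real
  assumes "0 \<le> a" "0 < e"
  shows "(\<Sum>i<n. e * of_bool (real (Suc i) * e < a)) \<le> min a (real n * e)"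
    and "min (a - e) (real n * e) \<le> (\<Sum>i<n. e * of_bool (real (Suc i) * e < a))"
proof (induction n)
  case 0
  show "(\<Sum>i<0. e * of_bool (real (Suc i) * e < a)) \<le> min a (real 0 * e)" using assms by simp
  show "min (a - e) (real 0 * e) \<le> (\<Sum>i<0. e * of_bool (real (Suc i) * e < a))" by simp
next
  case (Suc n)
  show "(\<Sum>i<Suc n. e * of_bool (real (Suc i) * e < a)) \<le> min a (real (Suc n) * e)"
    using Suc(1) assms unfolding sum.lessThan_Suc
    by (cases "real (Suc n) * e < a")
      (auto simp: algebra_simps
        simp del: sum_mult_of_bool_eq sum_of_bool_eq sum_of_bool_mult_eq)
  show "min (a - e) (real (Suc n) * e) \<le> (\<Sum>i<Suc n. e * of_bool (real (Suc i) * e < a))"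
    using Suc(2) assms unfolding sum.lessThan_Suc
    by (cases "real (Suc n) * e < a")
      (auto simp: algebra_simps min_def split: if_splits
        simp del: sum_mult_of_bool_eq sum_of_bool_eq sum_of_bool_mult_eq)
qed

text \<open>The \<open>C\<^sup>2\<close> functions between \<open>0\<close> and \<open>w\<close> with compact support in \<open>U\<close>.\<close>

definition C2_minorants :: "(real^'n \<Rightarrow> real) \<Rightarrow> (real^'n) set \<Rightarrow> (real^'n \<Rightarrow> real) set" where
  "C2_minorants w U = {g\<in>C2. (\<forall>y. 0 \<le> g y \<and> g y \<le> w y) \<and>
     (\<exists>L. compact L \<and> L \<subseteq> U \<and> (\<forall>y. y \<notin> L \<longrightarrow> g y = 0))}"

lemma layer_sum_minorant:
  fixes w :: "real^'n \<Rightarrow> real"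
  assumes w: "\<And>y. 0 \<le> w y" and e: "0 < e"
    and \<beta>: "\<And>i. \<beta> i \<in> C2" "\<And>i y. 0 \<le> \<beta> i y"
      "\<And>i y. \<beta> i y \<le> indicator {y\<in>U. real (Suc i) * e < w y} y"
      "\<And>i. \<exists>L. compact L \<and> L \<subseteq> {y\<in>U. real (Suc i) * e < w y} \<and> (\<forall>y. y \<notin> L \<longrightarrow> \<beta> i y = 0)"
  shows "(\<lambda>y. \<Sum>i<n. e * \<beta> i y) \<in> C2_minorants w U"
proof -
  obtain L where L: "\<And>i. compact (L i)" "\<And>i. L i \<subseteq> {y\<in>U. real (Suc i) * e < w y}"
    "\<And>i y. y \<notin> L i \<Longrightarrow> \<beta> i y = 0"
    using \<beta>(4) by metis
  have "(\<Sum>i<n. e * \<beta> i y) \<le> w y" for y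
  proof -
    have "\<beta> i y \<le> of_bool (real (Suc i) * e < w y)" for i
      by (rule order_trans[OF \<beta>(3)]) (simp add: indicator_def)
    hence "(\<Sum>i<n. e * \<beta> i y) \<le> (\<Sum>i<n. e * of_bool (real (Suc i) * e < w y))"
      using e by (intro sum_mono mult_left_mono) auto
    also have "\<dots> \<le> w y" using layer_sum(1)[OF w[of y] e, of n] by simp
    finally show ?thesis .
  qed
  moreover have "0 \<le> (\<Sum>i<n. e * \<beta> i y)" for y
    using \<beta>(2) e by (intro sum_nonneg) simp
  moreover have "(\<lambda>y. \<Sum>i<n. e * \<beta> i y) \<in> C2"
    using \<beta>(1) by (intro C2_sum C2_mult C2_const)
  moreover have "compact (\<Union>i<n. L i)" "(\<Union>i<n. L i) \<subseteq> U"
    using L by auto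
  moreover have "(\<Sum>i<n. e * \<beta> i y) = 0" if "y \<notin> (\<Union>i<n. L i)" for y
    using that L(3) by (intro sum.neutral) auto
  ultimately show ?thesis unfolding C2_minorants_def by blast
qed

text \<open>The functions in \<open>C2_minorants w U\<close> exhaust the integral of a lower semicontinuous \<open>w\<close> over
  \<open>U\<close>.  Fatou's lemma is used twice: the indicators of the open level sets of \<open>w\<close> are limits of
  \<open>C\<^sup>2\<close> bumps, and \<open>w\<close> is a limit of layer sums.\<close>

lemma nn_integral_le_of_C2_minorants:
  fixes w :: "real^'n \<Rightarrow> real"
  assumes M: "sets M = sets borel" and U: "open U"
    and lsc: "\<And>c. open {y. c < w y}" and w: "\<And>y. 0 \<le> w y"
    and bound: "\<And>g. g \<in> C2_minorants w U \<Longrightarrow> (\<integral>\<^sup>+y. ennreal (g y) \<partial>M) \<le> C"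
  shows "(\<integral>\<^sup>+y. ennreal (w y) * indicator U y \<partial>M) \<le> C"
proof -
  define V where "V e i = {y\<in>U. real (Suc i) * e < w y}" for e i
  have V: "open (V e i)" for e i
    using open_Int[OF U lsc] by (simp add: V_def Int_def)
  have [measurable]: "V e i \<in> sets M" for e i using V M by simp
  have layers: "(\<integral>\<^sup>+y. ennreal (\<Sum>i<n. e * indicator (V e i) y) \<partial>M) \<le> C" if e: "0 < e" for e n
  proof -
    define Q where "Q i \<beta> \<longleftrightarrow> (\<forall>m. \<beta> m \<in> C2) \<and>
        (\<forall>m y. 0 \<le> \<beta> m y \<and> \<beta> m y \<le> indicator (V e i) y) \<and>
        (\<forall>m. \<exists>L. compact L \<and> L \<subseteq> V e i \<and> (\<forall>y. y \<notin> L \<longrightarrow> \<beta> m y = 0)) \<and>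
        (\<forall>y. (\<lambda>m. \<beta> m y) \<longlonglongrightarrow> indicator (V e i) y)"
      for i and \<beta> :: "nat \<Rightarrow> real^'n \<Rightarrow> real"
    have "\<exists>\<beta>. Q i \<beta>" for i
      by (rule C2_approx_indicator[OF V[of e i]]) (unfold Q_def, blast)
    then obtain \<beta> where "\<And>i. Q i (\<beta> i)" by metis
    hence \<beta>: "\<beta> i m \<in> C2" "0 \<le> \<beta> i m y" "\<beta> i m y \<le> indicator (V e i) y"
      "\<exists>L. compact L \<and> L \<subseteq> V e i \<and> (\<forall>y. y \<notin> L \<longrightarrow> \<beta> i m y = 0)"
      "(\<lambda>m. \<beta> i m y) \<longlonglongrightarrow> indicator (V e i) y" for i m y
      by (auto simp: Q_def)
    have in_minorants: "(\<lambda>y. \<Sum>i<n. e * \<beta> i m y) \<in> C2_minorants w U" for m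
      using w e \<beta>(1-4)[unfolded V_def] by (rule layer_sum_minorant)
    show ?thesis
    proof (rule nn_integral_limit_le)
      show "(\<lambda>y. ennreal (\<Sum>i<n. e * \<beta> i m y)) \<in> borel_measurable M" for m
        using in_minorants[of m]
        by (auto simp: C2_minorants_def measurable_cong_sets[OF M refl] intro!: C2_borel)
      show "(\<lambda>m. ennreal (\<Sum>i<n. e * \<beta> i m y)) \<longlonglongrightarrow> ennreal (\<Sum>i<n. e * indicator (V e i) y)"
        for y
        by (intro tendsto_intros \<beta>)
      show "(\<integral>\<^sup>+y. ennreal (\<Sum>i<n. e * \<beta> i m y) \<partial>M) \<le> C" for m
        by (rule bound) (rule in_minorants)
    qed
  qed
  \<comment> \<open>Layers of height \<open>1 / (N + 1)\<close> up to height \<open>N + 1\<close>.\<close>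
  define e where "e N = 1 / real (Suc N)" for N
  define S where "S N y = (\<Sum>i<Suc N * Suc N. e N * indicator (V (e N) i) y)" for N y
  have "(\<lambda>N. S N y) \<longlonglongrightarrow> w y * indicator U y" for y
  proof (cases "y \<in> U")
    case False
    hence "S N y = 0" for N by (auto simp: S_def V_def)
    with False show ?thesis by simp
  next
    case True
    hence S: "S N y = (\<Sum>i<Suc N * Suc N. e N * of_bool (real (Suc i) * e N < w y))" for N
      unfolding S_def by (intro sum.cong) (auto simp: V_def indicator_def)
    have e: "e N > 0" "real (Suc N * Suc N) * e N = real (Suc N)" for N
      by (auto simp: e_def field_simps)
    have "e \<longlonglongrightarrow> 0"
      unfolding e_def using LIMSEQ_inverse_real_of_nat by (simp add: inverse_eq_divide)
    hence lim: "(\<lambda>N. w y - e N) \<longlonglongrightarrow> w y" by (auto intro!: tendsto_eq_intros)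
    have "S N y \<le> w y" for N
      using layer_sum(1)[OF w[of y] e(1)[of N], of "Suc N * Suc N"] unfolding S e(2) by simp
    moreover have "\<forall>\<^sub>F N in sequentially. w y - e N \<le> S N y"
    proof (rule eventually_sequentiallyI[of "nat \<lceil>w y\<rceil>"])
      fix N assume "nat \<lceil>w y\<rceil> \<le> N"
      hence "w y \<le> real (Suc N)" by linarith
      with layer_sum(2)[OF w[of y] e(1)[of N], of "Suc N * Suc N"] e(1)[of N] show "w y - e N \<le> S N y"
        unfolding S e(2) by simp
    qed
    ultimately have "(\<lambda>N. S N y) \<longlonglongrightarrow> w y"
      by (intro tendsto_sandwich[OF _ _ lim tendsto_const]) auto
    with True show ?thesis by simp
  qed
  hence "(\<lambda>N. ennreal (S N y)) \<longlonglongrightarrow> ennreal (w y * indicator U y)" for y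
    by (rule tendsto_ennrealI)
  hence "(\<lambda>N. ennreal (S N y)) \<longlonglongrightarrow> ennreal (w y) * indicator U y" for y
    by (cases "y \<in> U") (metis indicator_simps mult_1_right mult_zero_right ennreal_0)+
  thus ?thesis
  proof (rule nn_integral_limit_le[rotated])
    show "(\<integral>\<^sup>+y. ennreal (S N y) \<partial>M) \<le> C" for N
      unfolding S_def by (rule layers) (simp add: e_def)
  qed (unfold S_def, measurable)
qed

corollary C2_minorant_approx:
  fixes w :: "real^'n \<Rightarrow> real"
  assumes M: "sets M = sets borel" and U: "open U"
    and lsc: "\<And>c. open {y. c < w y}" and w: "\<And>y. 0 \<le> w y"
    and fin: "(\<integral>\<^sup>+y. ennreal (w y) * indicator U y \<partial>M) < \<infinity>" and e: "0 < e"
  obtains g where "g \<in> C2_minorants w U"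
    "(\<integral>\<^sup>+y. ennreal (w y - g y) * indicator U y \<partial>M) \<le> ennreal e"
proof -
  let ?I = "\<integral>\<^sup>+y. ennreal (w y) * indicator U y \<partial>M"
  have [measurable]: "w \<in> borel_measurable M" "U \<in> sets M"
    using M U lsc by (auto simp: borel_measurable_iff_greater measurable_cong_sets[OF M refl])
  have "\<exists>g\<in>C2_minorants w U. ?I \<le> (\<integral>\<^sup>+y. ennreal (g y) \<partial>M) + ennreal e"
  proof (rule ccontr)
    assume "\<not> ?thesis"
    hence less: "(\<integral>\<^sup>+y. ennreal (g y) \<partial>M) + ennreal e < ?I" if "g \<in> C2_minorants w U" for g
      using that by force
    have le: "(\<integral>\<^sup>+y. ennreal (g y) \<partial>M) \<le> ?I - ennreal e" if "g \<in> C2_minorants w U" for g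
    proof -
      have "(\<integral>\<^sup>+y. ennreal (g y) \<partial>M) = (\<integral>\<^sup>+y. ennreal (g y) \<partial>M) + ennreal e - ennreal e"
        by simp
      also have "\<dots> \<le> ?I - ennreal e" using less[OF that] by (intro ennreal_minus_mono) auto
      finally show ?thesis .
    qed
    have "?I \<le> ?I - ennreal e"
      using M U lsc w le by (rule nn_integral_le_of_C2_minorants)
    moreover have "(\<lambda>y. 0) \<in> C2_minorants w U" using w by (auto simp: C2_minorants_def C2_const)
    from less[OF this] have "0 < ?I" by (auto intro: le_less_trans)
    hence "?I - ennreal e < ?I" using fin e by (intro ennreal_between) auto
    ultimately show False by simp
  qed
  then obtain g where g: "g \<in> C2_minorants w U"
    and I: "?I \<le> (\<integral>\<^sup>+y. ennreal (g y) \<partial>M) + ennreal e" by blast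
  have [measurable]: "g \<in> borel_measurable M"
    using g C2_borel by (auto simp: C2_minorants_def measurable_cong_sets[OF M refl])
  have gle: "0 \<le> g y" "g y \<le> w y" "y \<notin> U \<Longrightarrow> g y = 0" for y
    using g by (auto simp: C2_minorants_def)
  have "(\<integral>\<^sup>+y. ennreal (g y) \<partial>M) \<le> ?I"
    using gle by (intro nn_integral_mono) (auto simp: indicator_def ennreal_leI)
  hence gfin: "(\<integral>\<^sup>+y. ennreal (g y) \<partial>M) \<noteq> \<infinity>" using fin by auto
  have "?I = (\<integral>\<^sup>+y. ennreal (g y) + ennreal (w y - g y) * indicator U y \<partial>M)"
    using gle by (intro nn_integral_cong)
       (auto simp: indicator_def ennreal_plus[symmetric] simp del: ennreal_plus)
  also have "\<dots> = (\<integral>\<^sup>+y. ennreal (g y) \<partial>M) + (\<integral>\<^sup>+y. ennreal (w y - g y) * indicator U y \<partial>M)"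
    by (intro nn_integral_add) measurable
  finally have "(\<integral>\<^sup>+y. ennreal (w y - g y) * indicator U y \<partial>M) \<le> ennreal e"
    using I gfin by (auto simp: ennreal_add_left_cancel_le)
  with g show thesis by (rule that)
qed

section \<open>Integrability with respect to the Levy measure\<close>

lemma sets_levy_measure [simp, measurable_cong]: "sets (levy_measure q) = sets borel"
  by (simp add: levy_measure_def)

lemma space_levy_measure [simp]: "space (levy_measure q) = UNIV"
  by (simp add: levy_measure_def)

lemma integrable_min_norm_square:
  fixes q :: "real^'n \<Rightarrow> real"
  assumes "levy_density q"
  shows "integrable (levy_measure q) (\<lambda>z. min 1 ((norm z)\<^sup>2))"
proof (rule integrableI_nonneg)
  have q [measurable]: "q \<in> borel_measurable borel" and q0: "\<And>z. 0 \<le> q z"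
    and fin: "(\<integral>\<^sup>+z\<in>{z. norm z < 1}. ennreal ((norm z)\<^sup>2 * q z) \<partial>lborel)
       + (\<integral>\<^sup>+z\<in>{z. 1 \<le> norm z}. ennreal (q z) \<partial>lborel) < \<infinity>"
    using assms by (auto simp: levy_density_def)
  have "(\<integral>\<^sup>+z. ennreal (min 1 ((norm z)\<^sup>2)) \<partial>levy_measure q) =
      (\<integral>\<^sup>+z. ennreal (q z) * ennreal (min 1 ((norm z)\<^sup>2)) \<partial>lborel)"
    unfolding levy_measure_def by (intro nn_integral_density) auto
  also have "\<dots> \<le> (\<integral>\<^sup>+z. ennreal ((norm z)\<^sup>2 * q z) * indicator {z. norm z < 1} z
       + ennreal (q z) * indicator {z. 1 \<le> norm z} z \<partial>lborel)"
  proof (intro nn_integral_mono)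
    fix z :: "real^'n"
    have "q z * min 1 ((norm z)\<^sup>2) \<le> (if norm z < 1 then (norm z)\<^sup>2 * q z else q z)"
      using q0[of z] by (auto simp: mult.commute[of _ "q z"] intro!: mult_left_mono mult_left_le)
    thus "ennreal (q z) * ennreal (min 1 ((norm z)\<^sup>2)) \<le>
        ennreal ((norm z)\<^sup>2 * q z) * indicator {z. norm z < 1} z
        + ennreal (q z) * indicator {z. 1 \<le> norm z} z"
      using q0[of z] by (auto simp: ennreal_mult[symmetric] intro!: ennreal_leI split: if_splits)
  qed
  also have "\<dots> = (\<integral>\<^sup>+z\<in>{z. norm z < 1}. ennreal ((norm z)\<^sup>2 * q z) \<partial>lborel)
       + (\<integral>\<^sup>+z\<in>{z. 1 \<le> norm z}. ennreal (q z) \<partial>lborel)"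
    by (intro nn_integral_add) measurable
  finally show "(\<integral>\<^sup>+z. ennreal (min 1 ((norm z)\<^sup>2)) \<partial>levy_measure q) < \<infinity>"
    using fin by (rule le_less_trans)
qed (auto simp: measurable_cong_sets[OF sets_levy_measure refl])

lemma levy_integrable_of_bound:
  fixes q :: "real^'n \<Rightarrow> real"
  assumes q: "levy_density q" and f: "f \<in> borel_measurable borel"
    and bound: "\<And>z. \<bar>f z\<bar> \<le> C * min 1 ((norm z)\<^sup>2)"
  shows "integrable (levy_measure q) f"
proof (rule Bochner_Integration.integrable_bound)
  show "integrable (levy_measure q) (\<lambda>z. C * min 1 ((norm z)\<^sup>2))"
    by (intro integrable_mult_right integrable_min_norm_square q)
  show "AE z in levy_measure q. norm (f z) \<le> norm (C * min 1 ((norm z)\<^sup>2))"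
    using bound by (auto intro!: AE_I2 order_trans[OF _ abs_ge_self])
qed (use f in \<open>simp add: measurable_cong_sets[OF sets_levy_measure refl]\<close>)

lemma AE_levy_measure_norm_neq:
  fixes q :: "real^'n \<Rightarrow> real"
  assumes "levy_density q"
  shows "AE z in levy_measure q. norm z \<noteq> r"
proof -
  have "sphere (0::real^'n) r \<in> null_sets lborel"
    using negligible_sphere[of "0::real^'n" r]
    by (simp add: negligible_iff_null_sets null_sets_completion_iff)
  hence "AE z in lborel. norm (z::real^'n) \<noteq> r"
    by (rule AE_I') (auto simp: sphere_def)
  moreover have "q \<in> borel_measurable borel" using assms by (simp add: levy_density_def)
  ultimately show ?thesis unfolding levy_measure_def by (subst AE_density) auto
qed

lemma levy_integrand_measurable:
  assumes "w \<in> borel_measurable borel"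
  shows "levy_integrand w p x \<in> borel_measurable borel"
proof -
  note [measurable] = assms
  show ?thesis unfolding levy_integrand_def[abs_def] by measurable
qed

lemma C2_taylor_bound:
  fixes f :: "real^'n \<Rightarrow> real"
  assumes f: "f \<in> C2"
  obtains C where "0 \<le> C"
    "\<And>z. norm z \<le> 1 \<Longrightarrow> \<bar>f (x + z) - f x - z \<bullet> grad f x\<bar> \<le> C * (norm z)\<^sup>2"
proof -
  have cont: "continuous_on (cball x 1) (hessian f)"
    using C2_has_grad_hess[OF f] by (auto simp: has_grad_hess_def intro: continuous_on_subset)
  have "bounded (hessian f ` cball x 1)"
    by (intro compact_imp_bounded compact_continuous_image cont compact_cball)
  then obtain B where B: "\<And>y. y \<in> cball x 1 \<Longrightarrow> norm (hessian f y) \<le> B"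
    unfolding bounded_iff by blast
  define C where "C = real CARD('n) * real CARD('n) * B"
  have "0 \<le> B" using B[of x] norm_ge_zero[of "hessian f x"] by (simp del: norm_ge_zero)
  hence C: "0 \<le> C" by (simp add: C_def)
  have onorm: "onorm (\<lambda>h. hessian f y *v h) \<le> C" if "y \<in> cball x 1" for y
    unfolding C_def
  proof (rule onorm_le_matrix_component)
    fix i j
    have "\<bar>hessian f y $ i $ j\<bar> \<le> norm (hessian f y $ i)" by (rule component_le_norm_cart)
    also have "\<dots> \<le> norm (hessian f y)" by (rule Finite_Cartesian_Product.norm_nth_le)
    also have "\<dots> \<le> B" by (rule B) (rule that)
    finally show "\<bar>hessian f y $ i $ j\<bar> \<le> B" .
  qed
  have lip: "norm (grad f y - grad f x) \<le> C * norm (y - x)" if "y \<in> cball x 1" for y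
  proof (rule differentiable_bound[where S = "cball x 1" and f' = "\<lambda>y h. hessian f y *v h"])
    fix y
    have "(grad f has_derivative (\<lambda>h. hessian f y *v h)) (at y)"
      using C2_has_grad_hess[OF f] by (simp add: has_grad_hess_def)
    thus "(grad f has_derivative (\<lambda>h. hessian f y *v h)) (at y within cball x 1)"
      by (rule has_derivative_at_withinI)
  qed (use that onorm in auto)
  have "\<bar>f (x + z) - f x - z \<bullet> grad f x\<bar> \<le> C * (norm z)\<^sup>2" if z: "norm z \<le> 1" for z
  proof -
    let ?g = "\<lambda>y. f y - (y - x) \<bullet> grad f x"
    let ?S = "cball x (norm z)"
    have "norm (?g (x + z) - ?g x) \<le> (C * norm z) * norm (x + z - x)"
    proof (rule differentiable_bound[where S = ?S and f' = "\<lambda>y h. h \<bullet> (grad f y - grad f x)"])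
      fix y assume y: "y \<in> ?S"
      have "(f has_derivative (\<lambda>h. h \<bullet> grad f y)) (at y)"
        using C2_has_grad_hess[OF f] by (simp add: has_grad_hess_def gderiv_def)
      hence "(?g has_derivative (\<lambda>h. h \<bullet> (grad f y - grad f x))) (at y)"
        by (auto intro!: derivative_eq_intros simp: inner_diff_right)
      thus "(?g has_derivative (\<lambda>h. h \<bullet> (grad f y - grad f x))) (at y within ?S)"
        by (rule has_derivative_at_withinI)
      show "onorm (\<lambda>h. h \<bullet> (grad f y - grad f x)) \<le> C * norm z"
      proof (rule onorm_le)
        fix h
        have "norm (h \<bullet> (grad f y - grad f x)) \<le> norm h * norm (grad f y - grad f x)"
          using Cauchy_Schwarz_ineq2[of h] by simp
        also have "\<dots> \<le> norm h * (C * norm (y - x))"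
          using y z by (intro mult_left_mono lip) auto
        also have "\<dots> \<le> norm h * (C * norm z)"
          using y C by (intro mult_left_mono) (auto simp: dist_norm norm_minus_commute)
        finally show "norm (h \<bullet> (grad f y - grad f x)) \<le> C * norm z * norm h"
          by (simp add: mult_ac)
      qed
    qed (auto simp: dist_norm)
    thus ?thesis by (simp add: power2_eq_square mult_ac)
  qed
  with C show thesis by (rule that)
qed

text \<open>Taylor's formula controls the singularity of the Levy measure at the origin, and boundedness
  suffices elsewhere.\<close>

lemma levy_integrable_C2:
  fixes f :: "real^'n \<Rightarrow> real"
  assumes q: "levy_density q" and f: "f \<in> C2"
    and bounded: "\<And>z. 1 < norm z \<Longrightarrow> \<bar>f (x + z) - f x\<bar> \<le> K"
  shows "integrable (levy_measure q) (levy_integrand f (grad f x) x)"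
proof -
  obtain C where C: "0 \<le> C"
    "\<And>z. norm z \<le> 1 \<Longrightarrow> \<bar>f (x + z) - f x - z \<bullet> grad f x\<bar> \<le> C * (norm z)\<^sup>2"
    using C2_taylor_bound[OF f] by blast
  show ?thesis
  proof (rule levy_integrable_of_bound[OF q levy_integrand_measurable[OF C2_borel[OF f]]])
    fix z :: "real^'n"
    show "\<bar>levy_integrand f (grad f x) x z\<bar> \<le> max C K * min 1 ((norm z)\<^sup>2)"
    proof (cases "norm z \<le> 1")
      case True
      hence "(norm z)\<^sup>2 \<le> 1" by (simp add: power_le_one)
      moreover have "C * (norm z)\<^sup>2 \<le> max C K * (norm z)\<^sup>2" by (intro mult_right_mono) auto
      ultimately show ?thesis using True C(2)[OF True] by (simp add: levy_integrand_def)
    next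
      case False
      hence "1 \<le> (norm z)\<^sup>2" by (simp add: one_le_power)
      thus ?thesis using False bounded[of z] by (simp add: levy_integrand_def)
    qed
  qed
qed

text \<open>If the positive part is integrable, a lower bound on the extended integral forces the negative
  part to be integrable too.\<close>

lemma integrable_of_ext_integral_ge:
  assumes f: "f \<in> borel_measurable M" and pos: "(\<integral>\<^sup>+z. ennreal (f z) \<partial>M) < \<infinity>"
    and c: "ereal c \<le> ext_integral M f"
  shows "integrable M f" "c \<le> integral\<^sup>L M f"
proof -
  define a b where "a = (\<integral>\<^sup>+z. ennreal (f z) \<partial>M)" and "b = (\<integral>\<^sup>+z. ennreal (- f z) \<partial>M)"
  obtain a' where a': "a = ennreal a'" "0 \<le> a'"
    using pos by (cases a) (auto simp: a_def)
  obtain b' where b': "b = ennreal b'" "0 \<le> b'"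
    using c a' by (cases b) (auto simp: ext_integral_def a_def[symmetric] b_def[symmetric])
  show int: "integrable M f"
    using f a' b' by (auto simp: real_integrable_def a_def b_def)
  show "c \<le> integral\<^sup>L M f"
    using c a' b' unfolding real_lebesgue_integral_def[OF int]
    by (simp add: ext_integral_def a_def[symmetric] b_def[symmetric])
qed

lemma ext_integral_ge_of_integrable:
  assumes f: "integrable M f" and h: "h \<in> borel_measurable M" and le: "\<And>z. f z \<le> h z"
  shows "has_ext_integral M h" "ereal (integral\<^sup>L M f) \<le> ext_integral M h"
proof -
  have "(\<integral>\<^sup>+z. ennreal (- h z) \<partial>M) \<le> (\<integral>\<^sup>+z. ennreal (- f z) \<partial>M)"
    using le by (intro nn_integral_mono ennreal_leI) simp
  also have "\<dots> < \<infinity>" using f by (auto simp: real_integrable_def less_top)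
  finally have neg: "(\<integral>\<^sup>+z. ennreal (- h z) \<partial>M) < \<infinity>" .
  with h show "has_ext_integral M h" by (simp add: has_ext_integral_def)
  obtain b where b: "(\<integral>\<^sup>+z. ennreal (- h z) \<partial>M) = ennreal b" "0 \<le> b"
    using neg by (cases "\<integral>\<^sup>+z. ennreal (- h z) \<partial>M") auto
  show "ereal (integral\<^sup>L M f) \<le> ext_integral M h"
  proof (cases "\<integral>\<^sup>+z. ennreal (h z) \<partial>M")
    case (real a)
    have int: "integrable M h" using h real b by (auto simp: real_integrable_def)
    have "integral\<^sup>L M f \<le> integral\<^sup>L M h" using f int le by (rule integral_mono)
    also have "\<dots> = a - b" unfolding real_lebesgue_integral_def[OF int] using real b by simp
    finally show ?thesis using real b by (simp add: ext_integral_def)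
  next
    case top
    thus ?thesis using b by (simp add: ext_integral_def)
  qed
qed

section \<open>Subsolutions\<close>

lemma grad_diff:
  assumes "f \<in> C2" "g \<in> C2"
  shows "grad (\<lambda>y. f y - g y) x = grad f x - grad g x"
  using assms by (auto simp: has_grad_hess_def intro!: grad_eqI GDERIV_diff dest!: C2_has_grad_hess)

lemma open_Collect_eventually:
  assumes "\<And>x. P x \<Longrightarrow> \<forall>\<^sub>F y in nhds x. P y"
  shows "open {x. P x}"
proof (subst open_subopen, intro ballI)
  fix x assume "x \<in> {x. P x}"
  hence "\<forall>\<^sub>F y in nhds x. P y" using assms by simp
  thus "\<exists>T. open T \<and> x \<in> T \<and> T \<subseteq> {x. P x}" unfolding eventually_nhds by blast
qed

lemma USC_measurable:
  assumes "u \<in> USC"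
  shows "u \<in> borel_measurable borel"
proof -
  have "open {y. u y < c}" for c
    using assms by (intro open_Collect_eventually) (simp add: USC_def)
  thus ?thesis by (auto simp: borel_measurable_iff_less)
qed

lemma open_superlevel_diff_USC:
  fixes u \<phi> :: "real^'n \<Rightarrow> real"
  assumes u: "u \<in> USC" and \<phi>: "continuous_on UNIV \<phi>"
  shows "open {y. c < \<phi> y - u y}"
proof (rule open_Collect_eventually)
  fix y assume y: "c < \<phi> y - u y"
  obtain m where m: "u y < m" "m < \<phi> y - c" using dense[of "u y" "\<phi> y - c"] y by auto
  have "\<forall>\<^sub>F z in nhds y. u z < m" using u m(1) by (auto simp: USC_def)
  moreover have "(\<phi> \<longlongrightarrow> \<phi> y) (nhds y)"
    using \<phi> by (simp add: continuous_on_eq_continuous_at isCont_def tendsto_at_iff_tendsto_nhds)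
  hence "\<forall>\<^sub>F z in nhds y. m + c < \<phi> z" using m(2) by (intro order_tendstoD) auto
  ultimately show "\<forall>\<^sub>F z in nhds y. c < \<phi> z - u z" by eventually_elim simp
qed

text \<open>The image of the Levy measure under \<open>z \<mapsto> x + z\<close>.\<close>

abbreviation shifted_levy :: "(real^'n \<Rightarrow> real) \<Rightarrow> real^'n \<Rightarrow> (real^'n) measure" where
  "shifted_levy q x \<equiv> distr (levy_measure q) borel (\<lambda>z. x + z)"

lemma nn_integral_shifted_levy:
  "f \<in> borel_measurable borel \<Longrightarrow>
     (\<integral>\<^sup>+y. f y \<partial>shifted_levy q x) = (\<integral>\<^sup>+z. f (x + z) \<partial>levy_measure q)"
  by (rule nn_integral_distr) auto

lemma borel_shift: "f \<in> borel_measurable borel \<Longrightarrow> (\<lambda>z. f (x + z)) \<in> borel_measurable borel"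
  for f :: "real^'n \<Rightarrow> 'b::topological_space"
  by (rule measurable_compose[where N = borel]) measurable

lemma levy_measure_measurable_iff:
  "f \<in> borel_measurable (levy_measure q) \<longleftrightarrow> f \<in> borel_measurable borel"
  by (rule measurable_cong_sets[THEN arg_cong[where f = "\<lambda>A. f \<in> A"]]) auto

text \<open>A lower bound for the nonlocal terms of all test functions with the gradient and the Hessian of
  \<open>\<Phi>\<close> at \<open>x\<close> passes to \<open>u\<close>: apply it to \<open>\<Phi> - g\<close>, where \<open>g\<close> runs through the \<open>C\<^sup>2\<close> minorants
  of \<open>\<Phi> - u\<close> that vanish near \<open>x\<close>.\<close>

lemma nonlocal_bound_passes_to_subsolution:
  fixes q :: "real^'n \<Rightarrow> real"
  assumes u: "u \<in> USC" and \<Phi>: "touches_above \<Phi> u x"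
    and int: "integrable (levy_measure q) (levy_integrand \<Phi> (grad \<Phi> x) x)"
    and bound: "\<And>\<psi>. touches_above \<psi> u x \<Longrightarrow> grad \<psi> x = grad \<Phi> x \<Longrightarrow> hessian \<psi> x = hessian \<Phi> x \<Longrightarrow>
      ereal c \<le> ext_integral (levy_measure q) (levy_integrand \<psi> (grad \<psi> x) x)"
  shows "integrable (levy_measure q) (levy_integrand u (grad \<Phi> x) x)"
    and "c \<le> (\<integral>z. levy_integrand u (grad \<Phi> x) x z \<partial>levy_measure q)"
proof -
  let ?M = "levy_measure q" and ?p = "grad \<Phi> x"
  define I where "I = (\<integral>z. levy_integrand \<Phi> ?p x z \<partial>?M)"
  define w where "w y = \<Phi> y - u y" for y
  have \<Phi>C2: "\<Phi> \<in> C2" and \<Phi>x: "u x = \<Phi> x" using \<Phi> by (auto simp: touches_above_def)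
  have w0: "0 \<le> w y" for y using \<Phi> by (auto simp: touches_above_def w_def)
  have wborel: "w \<in> borel_measurable borel"
    using C2_borel[OF \<Phi>C2] USC_measurable[OF u] by (simp add: w_def[abs_def])
  have minorant: "(\<integral>\<^sup>+z. ennreal (g (x + z)) \<partial>?M) \<le> ennreal (I - c) \<and> c \<le> I"
    if g: "g \<in> C2_minorants w (- {x})" for g
  proof -
    obtain L where g': "g \<in> C2" "\<And>y. 0 \<le> g y" "\<And>y. g y \<le> w y" and L: "compact L" "x \<notin> L"
      "\<And>y. y \<notin> L \<Longrightarrow> g y = 0"
      using g by (auto simp: C2_minorants_def)
    define \<psi> where "\<psi> y = \<Phi> y - g y" for y
    have "\<forall>\<^sub>F y in nhds x. y \<in> - L"
      using L by (intro eventually_nhds_in_open) (auto simp: compact_imp_closed open_Compl)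
    hence ev: "\<forall>\<^sub>F y in nhds x. \<psi> y = \<Phi> y"
      by eventually_elim (simp add: \<psi>_def L)
    have \<psi>C2: "\<psi> \<in> C2" unfolding \<psi>_def[abs_def] by (intro C2_diff \<Phi>C2 g')
    have touch: "touches_above \<psi> u x"
      using g'(3) L \<Phi>x \<psi>C2 by (auto simp: touches_above_def \<psi>_def w_def algebra_simps)
    have gr: "grad \<psi> x = ?p" by (rule grad_cong) (rule ev)
    have \<psi>_eq: "levy_integrand \<psi> ?p x z = levy_integrand \<Phi> ?p x z - g (x + z)" for z
      using L by (simp add: levy_integrand_def \<psi>_def)
    have ext: "ereal c \<le> ext_integral ?M (levy_integrand \<psi> ?p x)"
      using bound[OF touch gr hessian_cong[OF ev]] by (simp add: gr)
    have meas: "levy_integrand \<psi> ?p x \<in> borel_measurable ?M"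
      by (simp add: levy_measure_measurable_iff levy_integrand_measurable C2_borel \<psi>C2)
    have "(\<integral>\<^sup>+z. ennreal (levy_integrand \<psi> ?p x z) \<partial>?M) \<le>
        (\<integral>\<^sup>+z. ennreal (levy_integrand \<Phi> ?p x z) \<partial>?M)"
      using g'(2) by (intro nn_integral_mono ennreal_leI) (simp add: \<psi>_eq)
    also have "\<dots> < \<infinity>" using int by (auto simp: real_integrable_def less_top)
    finally have pos: "(\<integral>\<^sup>+z. ennreal (levy_integrand \<psi> ?p x z) \<partial>?M) < \<infinity>" .
    have int\<psi>: "integrable ?M (levy_integrand \<psi> ?p x)"
      and c: "c \<le> (\<integral>z. levy_integrand \<psi> ?p x z \<partial>?M)"
      using integrable_of_ext_integral_ge[OF meas pos ext] by auto
    have g_eq: "g (x + z) = levy_integrand \<Phi> ?p x z - levy_integrand \<psi> ?p x z" for z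
      by (simp add: \<psi>_eq)
    have intg: "integrable ?M (\<lambda>z. g (x + z))"
      unfolding g_eq by (intro Bochner_Integration.integrable_diff int int\<psi>)
    have "(\<integral>z. g (x + z) \<partial>?M) = I - (\<integral>z. levy_integrand \<psi> ?p x z \<partial>?M)"
      unfolding g_eq I_def by (intro Bochner_Integration.integral_diff int int\<psi>)
    hence "(\<integral>z. g (x + z) \<partial>?M) \<le> I - c" using c by simp
    moreover have "0 \<le> (\<integral>z. g (x + z) \<partial>?M)" using g' by (intro integral_nonneg_AE) simp
    moreover have "(\<integral>\<^sup>+z. ennreal (g (x + z)) \<partial>?M) = ennreal (\<integral>z. g (x + z) \<partial>?M)"
      using intg g' by (intro nn_integral_eq_integral) auto
    ultimately show ?thesis by (auto intro: ennreal_leI)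
  qed
  have "(\<lambda>y. 0) \<in> C2_minorants w (- {x})" using w0 by (auto simp: C2_minorants_def C2_const)
  with minorant have cI: "c \<le> I" by blast
  have "(\<integral>\<^sup>+y. ennreal (w y) * indicator (- {x}) y \<partial>shifted_levy q x) \<le> ennreal (I - c)"
  proof (rule nn_integral_le_of_C2_minorants)
    show "open {y. a < w y}" for a
      unfolding w_def using u C2_continuous[OF \<Phi>C2] by (rule open_superlevel_diff_USC)
    fix g assume g: "g \<in> C2_minorants w (- {x})"
    hence "g \<in> borel_measurable borel" by (auto simp: C2_minorants_def C2_borel)
    thus "(\<integral>\<^sup>+y. ennreal (g y) \<partial>shifted_levy q x) \<le> ennreal (I - c)"
      using minorant[OF g] by (subst nn_integral_shifted_levy) auto
  qed (use w0 in auto)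
  also have "(\<integral>\<^sup>+y. ennreal (w y) * indicator (- {x}) y \<partial>shifted_levy q x) =
      (\<integral>\<^sup>+y. ennreal (w y) \<partial>shifted_levy q x)"
    using \<Phi>x by (intro nn_integral_cong) (auto simp: indicator_def w_def)
  also have "\<dots> = (\<integral>\<^sup>+z. ennreal (w (x + z)) \<partial>?M)"
    using wborel by (intro nn_integral_shifted_levy) simp
  finally have le: "(\<integral>\<^sup>+z. ennreal (w (x + z)) \<partial>?M) \<le> ennreal (I - c)" .
  have intw: "integrable ?M (\<lambda>z. w (x + z))"
  proof (rule integrableI_nonneg)
    show "(\<integral>\<^sup>+z. ennreal (w (x + z)) \<partial>?M) < \<infinity>" using le by (rule le_less_trans) simp
  qed (use w0 wborel in \<open>auto simp: levy_measure_measurable_iff intro: borel_shift\<close>)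
  have "ennreal (\<integral>z. w (x + z) \<partial>?M) \<le> ennreal (I - c)"
    using le w0 by (subst nn_integral_eq_integral[OF intw, symmetric]) auto
  hence wle: "(\<integral>z. w (x + z) \<partial>?M) \<le> I - c" using cI by simp
  have u_eq: "levy_integrand u ?p x z = levy_integrand \<Phi> ?p x z - w (x + z)" for z
    using \<Phi>x by (simp add: levy_integrand_def w_def)
  show "integrable ?M (levy_integrand u ?p x)"
    using Bochner_Integration.integrable_diff[OF int intw] by (simp add: u_eq[abs_def])
  show "c \<le> (\<integral>z. levy_integrand u ?p x z \<partial>?M)"
    using Bochner_Integration.integral_diff[OF int intw] wle by (simp add: u_eq I_def)
qed

text \<open>Two test functions may have different gradients at \<open>x\<close>.  Interpolating between them gives one
  that agrees with the first near \<open>x\<close> and with the second far from \<open>x\<close>.\<close>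

lemma touching_function_gluing:
  fixes q :: "real^'n \<Rightarrow> real"
  assumes q: "levy_density q" and \<phi>: "touches_above \<phi> u x" and \<psi>: "touches_above \<psi> u x"
    and int: "integrable (levy_measure q) (levy_integrand \<psi> (grad \<psi> x) x)"
  obtains \<Phi> where "touches_above \<Phi> u x" "grad \<Phi> x = grad \<phi> x" "hessian \<Phi> x = hessian \<phi> x"
    "integrable (levy_measure q) (levy_integrand \<Phi> (grad \<Phi> x) x)"
proof -
  obtain \<kappa> where \<kappa>: "\<kappa> \<in> C2" "\<And>y. 0 \<le> \<kappa> y" "\<And>y. \<kappa> y \<le> 1"
    "\<And>y. norm (y - x) \<le> 1 / 2 \<Longrightarrow> \<kappa> y = 0" "\<And>y. 1 \<le> norm (y - x) \<Longrightarrow> \<kappa> y = 1"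
    by (rule C2_cutoff[of 1 x]) auto
  have C2: "\<phi> \<in> C2" "\<psi> \<in> C2" and x: "\<phi> x = u x" "\<psi> x = u x"
    and above: "\<And>y. u y \<le> \<phi> y" "\<And>y. u y \<le> \<psi> y"
    using \<phi> \<psi> by (auto simp: touches_above_def)
  define \<Phi> where "\<Phi> y = \<phi> y + \<kappa> y * (\<psi> y - \<phi> y)" for y
  have \<Phi>C2: "\<Phi> \<in> C2" unfolding \<Phi>_def[abs_def] by (intro C2_add C2_mult C2_diff \<kappa> C2)
  have "u y \<le> \<Phi> y" for y
  proof -
    have "0 \<le> (1 - \<kappa> y) * (\<phi> y - u y) + \<kappa> y * (\<psi> y - u y)"
      using \<kappa>(2,3) above by (intro add_nonneg_nonneg mult_nonneg_nonneg) auto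
    thus ?thesis by (simp add: \<Phi>_def algebra_simps)
  qed
  moreover have \<Phi>x: "\<Phi> x = u x" by (simp add: \<Phi>_def x)
  ultimately have touch: "touches_above \<Phi> u x" using \<Phi>C2 by (simp add: touches_above_def)
  have "\<forall>\<^sub>F y in nhds x. y \<in> ball x (1/2)" by (intro eventually_nhds_in_open) auto
  hence ev: "\<forall>\<^sub>F y in nhds x. \<Phi> y = \<phi> y"
    by eventually_elim (simp add: \<Phi>_def \<kappa>(4) dist_norm norm_minus_commute)
  \<comment> \<open>The difference \<open>d\<close> vanishes outside the unit ball around \<open>x\<close>, so its Levy integrand is integrable.\<close>
  define d where "d y = \<Phi> y - \<psi> y" for y
  have dC2: "d \<in> C2" unfolding d_def[abs_def] by (intro C2_diff \<Phi>C2 C2)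
  have gd: "grad d x = grad \<Phi> x - grad \<psi> x"
    unfolding d_def[abs_def] by (rule grad_diff[OF \<Phi>C2 C2(2)])
  have "integrable (levy_measure q) (levy_integrand d (grad d x) x)"
  proof (rule levy_integrable_C2[OF q dC2])
    show "\<bar>d (x + z) - d x\<bar> \<le> 0" if "1 < norm z" for z
      using that \<kappa>(5)[of "x + z"] by (simp add: d_def \<Phi>_def x)
  qed
  moreover have sum_eq: "levy_integrand \<psi> (grad \<psi> x) x z + levy_integrand d (grad d x) x z =
      levy_integrand \<Phi> (grad \<Phi> x) x z" for z
    unfolding gd by (simp add: levy_integrand_def d_def inner_diff_right algebra_simps)
  hence "(\<lambda>z. levy_integrand \<psi> (grad \<psi> x) x z + levy_integrand d (grad d x) x z) =
      levy_integrand \<Phi> (grad \<Phi> x) x" by (rule ext)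
  ultimately have "integrable (levy_measure q) (levy_integrand \<Phi> (grad \<Phi> x) x)"
    using Bochner_Integration.integrable_add[OF int] by metis
  with touch grad_cong[OF ev] hessian_cong[OF ev] show thesis by (rule that)
qed

lemma subsolution_B_imp_C:
  fixes q :: "real^'n \<Rightarrow> real"
  assumes q: "levy_density q" and B: "viscosity_subsolution_B \<Omega> F q u"
  shows "viscosity_subsolution_C \<Omega> F q u"
  unfolding viscosity_subsolution_C_def
proof (intro conjI ballI allI impI)
  show u: "u \<in> USC" using B by (simp add: viscosity_subsolution_B_def)
  fix x \<phi> assume x: "x \<in> \<Omega>" and \<phi>: "touches_above \<phi> u x"
  from B x \<phi> obtain \<psi> where \<psi>: "touches_above \<psi> u x"
    "integrable (levy_measure q) (levy_integrand \<psi> (grad \<psi> x) x)"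
    unfolding viscosity_subsolution_B_def by blast
  obtain \<Phi> where \<Phi>: "touches_above \<Phi> u x" "grad \<Phi> x = grad \<phi> x" "hessian \<Phi> x = hessian \<phi> x"
    "integrable (levy_measure q) (levy_integrand \<Phi> (grad \<Phi> x) x)"
    by (rule touching_function_gluing[OF q \<phi> \<psi>])
  have test: "ereal (F x (u x) (grad \<phi> x) (hessian \<phi> x)) \<le>
      ext_integral (levy_measure q) (levy_integrand \<psi> (grad \<psi> x) x)"
    if "touches_above \<psi> u x" "grad \<psi> x = grad \<Phi> x" "hessian \<psi> x = hessian \<Phi> x" for \<psi>
  proof -
    have *: "a \<le> b" if "a - b \<le> 0" for a b :: ereal
      using that by (cases a; cases b) auto
    have "ereal (F x (u x) (grad \<psi> x) (hessian \<psi> x))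
        - ext_integral (levy_measure q) (levy_integrand \<psi> (grad \<psi> x) x) \<le> 0"
      using B x that(1) unfolding viscosity_subsolution_B_def by blast
    from *[OF this] show ?thesis by (simp only: that(2,3) \<Phi>(2,3))
  qed
  show "integrable (levy_measure q) (levy_integrand u (grad \<phi> x) x)"
    using nonlocal_bound_passes_to_subsolution(1)[OF u \<Phi>(1,4) test] by (simp only: \<Phi>(2))
  have "F x (u x) (grad \<phi> x) (hessian \<phi> x) \<le>
      (\<integral>z. levy_integrand u (grad \<Phi> x) x z \<partial>levy_measure q)"
    using u \<Phi>(1,4) test by (rule nonlocal_bound_passes_to_subsolution(2))
  thus "F x (u x) (grad \<phi> x) (hessian \<phi> x)
      - (\<integral>z. levy_integrand u (grad \<phi> x) x z \<partial>levy_measure q) \<le> 0"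
    by (simp only: \<Phi>(2) diff_le_0_iff_le)
qed

text \<open>If the Levy integrand of \<open>u\<close> is integrable, then so is that of some test function: from \<open>\<phi>\<close>
  subtract, on each annulus \<open>k + 1 < norm (y - x) < k + 2\<close>, a \<open>C\<^sup>2\<close> minorant of \<open>\<phi> - u\<close> whose
  integral over the annulus is within \<open>(1/2) ^ k\<close> of that of \<open>\<phi> - u\<close>.  The spheres
  between the annuli are null sets.\<close>

lemma integrable_touching_function:
  fixes q :: "real^'n \<Rightarrow> real"
  assumes q: "levy_density q" and u: "u \<in> USC" and \<phi>: "touches_above \<phi> u x"
    and int: "integrable (levy_measure q) (levy_integrand u (grad \<phi> x) x)"
  obtains \<psi> where "touches_above \<psi> u x"
    "integrable (levy_measure q) (levy_integrand \<psi> (grad \<psi> x) x)"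
proof -
  let ?M = "levy_measure q" and ?p = "grad \<phi> x"
  define U where "U (k::nat) = {y. real k + 1 < norm (y - x) \<and> norm (y - x) < real k + 2}" for k
  have U: "open (U k)" for k
    unfolding U_def by (intro open_Collect_conj open_Collect_less continuous_intros)
  define w where "w y = \<phi> y - u y" for y
  have \<phi>C2: "\<phi> \<in> C2" and \<phi>x: "\<phi> x = u x" and w0: "0 \<le> w y" for y
    using \<phi> by (auto simp: touches_above_def w_def)
  have wborel [measurable]: "w \<in> borel_measurable borel"
    using C2_borel[OF \<phi>C2] USC_measurable[OF u] by (simp add: w_def[abs_def])
  \<comment> \<open>On an annulus \<open>\<phi>\<close> is bounded and \<open>u\<close> is integrable.\<close>
  have fin: "(\<integral>\<^sup>+y. ennreal (w y) * indicator (U k) y \<partial>shifted_levy q x) < \<infinity>" for k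
  proof -
    have "bounded (\<phi> ` cball x (real k + 2))"
      by (intro compact_imp_bounded compact_continuous_image C2_continuous \<phi>C2 compact_cball)
    then obtain B where B: "\<And>y. y \<in> cball x (real k + 2) \<Longrightarrow> norm (\<phi> y) \<le> B"
      unfolding bounded_iff by blast
    let ?h = "\<lambda>z. 2 * B * min 1 ((norm z)\<^sup>2) - levy_integrand u ?p x z"
    have h: "integrable ?M ?h"
      by (intro Bochner_Integration.integrable_diff integrable_mult_right
          integrable_min_norm_square q int)
    have "(\<integral>\<^sup>+y. ennreal (w y) * indicator (U k) y \<partial>shifted_levy q x) =
        (\<integral>\<^sup>+z. ennreal (w (x + z)) * indicator (U k) (x + z) \<partial>?M)"
      using U[of k] by (intro nn_integral_shifted_levy) measurable
    also have "\<dots> \<le> (\<integral>\<^sup>+z. ennreal (norm (?h z)) \<partial>?M)"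
    proof (intro nn_integral_mono)
      fix z
      show "ennreal (w (x + z)) * indicator (U k) (x + z) \<le> ennreal (norm (?h z))"
      proof (cases "x + z \<in> U k")
        case True
        hence z: "1 < norm z" "norm z \<le> real k + 2" by (auto simp: U_def)
        hence "1 \<le> (norm z)\<^sup>2" by (simp add: one_le_power)
        moreover have "\<bar>\<phi> (x + z)\<bar> \<le> B" "\<bar>\<phi> x\<bar> \<le> B"
          using B[of "x + z"] B[of x] z by (auto simp: dist_norm)
        ultimately have "w (x + z) \<le> ?h z"
          using z(1) by (simp add: w_def levy_integrand_def \<phi>x)
        hence "w (x + z) \<le> norm (?h z)" unfolding real_norm_def by linarith
        thus ?thesis using True by (simp add: ennreal_leI)
      qed simp
    qed
    also have "\<dots> < \<infinity>" using h by (simp add: integrable_iff_bounded)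
    finally show ?thesis .
  qed
  have "\<exists>g\<in>C2_minorants w (U k).
      (\<integral>\<^sup>+y. ennreal (w y - g y) * indicator (U k) y \<partial>shifted_levy q x) \<le> ennreal ((1/2) ^ k)" for k
  proof -
    have lsc: "open {y. a < w y}" for a
      unfolding w_def using u C2_continuous[OF \<phi>C2] by (rule open_superlevel_diff_USC)
    have M: "sets (shifted_levy q x) = sets borel" and e: "0 < (1/2::real) ^ k" by simp_all
    show ?thesis
      by (rule C2_minorant_approx[OF M U lsc w0 fin e]) blast
  qed
  then obtain g where g: "\<And>k. g k \<in> C2_minorants w (U k)" and
    approx: "\<And>k. (\<integral>\<^sup>+y. ennreal (w y - g k y) * indicator (U k) y \<partial>shifted_levy q x)
       \<le> ennreal ((1/2) ^ k)"
    by metis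
  have gC2: "g k \<in> C2" and g0: "0 \<le> g k y" and gw: "g k y \<le> w y"
    and gU: "y \<notin> U k \<Longrightarrow> g k y = 0" for k y
    using g[of k] by (auto simp: C2_minorants_def)
  define G where "G y = (\<Sum>k<nat \<lceil>norm (y - x)\<rceil>. g k y)" for y
  \<comment> \<open>The sum is locally finite because \<open>g k\<close> vanishes on the ball of radius \<open>k + 1\<close>.\<close>
  have G_eq: "G y = (\<Sum>k<K. g k y)" if "norm (y - x) \<le> real K" for y K
  proof -
    have "nat \<lceil>norm (y - x)\<rceil> \<le> K" using that by (simp add: ceiling_le_iff nat_le_iff)
    moreover have "g k y = 0" if "norm (y - x) \<le> real k" for k
      using that by (intro gU) (auto simp: U_def)
    ultimately show ?thesis unfolding G_def by (intro sum.mono_neutral_left) auto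
  qed
  have GC2: "G \<in> C2"
  proof (rule C2_local)
    fix y0
    define K where "K = nat \<lceil>norm (y0 - x) + 1\<rceil>"
    have "\<forall>\<^sub>F y in nhds y0. y \<in> ball y0 1" by (intro eventually_nhds_in_open) auto
    hence "\<forall>\<^sub>F y in nhds y0. G y = (\<Sum>k<K. g k y)"
    proof eventually_elim
      case (elim y)
      hence "norm (y - y0) \<le> 1" by (simp add: dist_norm norm_minus_commute)
      hence "norm (y - x) \<le> norm (y0 - x) + 1"
        using norm_triangle_ineq[of "y - y0" "y0 - x"] by simp
      also have "\<dots> \<le> real K" unfolding K_def by linarith
      finally show ?case by (rule G_eq)
    qed
    moreover have "(\<lambda>y. \<Sum>k<K. g k y) \<in> C2" by (intro C2_sum gC2)
    ultimately show "\<exists>h\<in>C2. \<forall>\<^sub>F y in nhds y0. G y = h y" by (rule bexI)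
  qed
  have G_U: "G y = g k y" if y: "y \<in> U k" for y k
  proof -
    have "norm (y - x) \<le> real (k + 2)" using y by (simp add: U_def)
    hence "G y = (\<Sum>j<k + 2. g j y)" by (rule G_eq)
    also have "\<dots> = (\<Sum>j\<in>{k}. g j y)"
    proof (rule sum.mono_neutral_right)
      show "\<forall>j\<in>{..<k + 2} - {k}. g j y = 0"
      proof
        fix j assume "j \<in> {..<k + 2} - {k}"
        hence "j + 1 \<le> k \<or> k + 1 \<le> j" by auto
        hence "real j + 1 \<le> real k \<or> real k + 1 \<le> real j" by linarith
        hence "y \<notin> U j" using y by (auto simp: U_def)
        thus "g j y = 0" by (rule gU)
      qed
    qed auto
    finally show ?thesis by simp
  qed
  have G_out: "G y = 0" if "\<And>k. y \<notin> U k" for y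
    unfolding G_def using that gU by (intro sum.neutral) auto
  have G0: "0 \<le> G y" for y using g0 by (auto simp: G_def intro!: sum_nonneg)
  have Gw: "G y \<le> w y" for y
    by (cases "\<exists>k. y \<in> U k") (auto simp: G_U gw G_out w0)
  have G_near: "G y = 0" if "norm (y - x) \<le> 1" for y
    using that by (intro G_out) (auto simp: U_def)

  define \<psi> where "\<psi> y = \<phi> y - G y" for y
  have \<psi>C2: "\<psi> \<in> C2" unfolding \<psi>_def[abs_def] by (intro C2_diff \<phi>C2 GC2)
  have touch: "touches_above \<psi> u x"
    using Gw \<phi>x \<psi>C2 by (simp add: touches_above_def \<psi>_def w_def G_near algebra_simps)
  have "\<forall>\<^sub>F y in nhds x. y \<in> ball x 1" by (intro eventually_nhds_in_open) auto
  hence "\<forall>\<^sub>F y in nhds x. \<psi> y = \<phi> y"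
    by eventually_elim (simp add: \<psi>_def G_near dist_norm norm_minus_commute)
  hence gr: "grad \<psi> x = ?p" by (rule grad_cong)

  \<comment> \<open>The Levy integrand of \<open>\<psi>\<close> is that of \<open>\<phi>\<close> on the unit ball, which Taylor's formula controls,
    and that of \<open>u\<close> plus the remainder \<open>R\<close> outside.\<close>
  have [measurable]: "G \<in> borel_measurable borel" by (rule C2_borel) (rule GC2)
  define R where "R z = indicator {z. 1 < norm z} z * (w (x + z) - G (x + z))" for z
  have R0: "0 \<le> R z" for z using Gw by (simp add: R_def)
  have [measurable]: "R \<in> borel_measurable borel"
    using wborel unfolding R_def[abs_def] by measurable
  have intR: "integrable ?M R"
  proof (rule integrableI_nonneg)
    have [measurable]: "g k \<in> borel_measurable borel" "U k \<in> sets borel" for k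
      using gC2 U by (auto intro: C2_borel)
    have "AE z in ?M. \<forall>k::nat. norm z \<noteq> real k"
      unfolding AE_all_countable using AE_levy_measure_norm_neq[OF q] by blast
    hence ae: "AE z in ?M. ennreal (R z) \<le>
        (\<Sum>k. ennreal (w (x + z) - g k (x + z)) * indicator (U k) (x + z))"
    proof eventually_elim
      case (elim z)
      show ?case
      proof (cases "1 < norm z")
        case True
        define k where "k = nat \<lfloor>norm z\<rfloor> - 1"
        have "real k + 1 = real_of_int \<lfloor>norm z\<rfloor>"
          using True by (simp add: k_def le_nat_iff le_floor_iff of_nat_diff)
        moreover have "norm z \<noteq> real (k + 1)" using elim by blast
        ultimately have "real k + 1 < norm z" "norm z < real k + 2"
          by linarith+
        hence k: "x + z \<in> U k" by (simp add: U_def)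
        have "ennreal (R z) =
            (\<Sum>j\<in>{k}. ennreal (w (x + z) - g j (x + z)) * indicator (U j) (x + z))"
          using True k by (simp add: R_def G_U)
        also have "\<dots> \<le> (\<Sum>j. ennreal (w (x + z) - g j (x + z)) * indicator (U j) (x + z))"
          by (intro sum_le_suminf) auto
        finally show ?thesis .
      qed (simp add: R_def)
    qed
    have "(\<integral>\<^sup>+z. ennreal (R z) \<partial>?M) \<le>
        (\<integral>\<^sup>+z. (\<Sum>k. ennreal (w (x + z) - g k (x + z)) * indicator (U k) (x + z)) \<partial>?M)"
      using ae by (rule nn_integral_mono_AE)
    also have "\<dots> = (\<Sum>k. \<integral>\<^sup>+z. ennreal (w (x + z) - g k (x + z)) * indicator (U k) (x + z) \<partial>?M)"
      by (intro nn_integral_suminf) measurable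
    also have "\<dots> = (\<Sum>k. \<integral>\<^sup>+y. ennreal (w y - g k y) * indicator (U k) y \<partial>shifted_levy q x)"
      by (intro suminf_cong nn_integral_shifted_levy[symmetric]) measurable
    also have "\<dots> \<le> (\<Sum>k. ennreal ((1/2) ^ k))"
      by (intro suminf_le approx) auto
    also have "\<dots> = ennreal (\<Sum>k. (1/2) ^ k)"
      by (intro suminf_ennreal2) (auto intro: summable_geometric)
    also have "\<dots> < \<infinity>" by simp
    finally show "(\<integral>\<^sup>+z. ennreal (R z) \<partial>?M) < \<infinity>" .
  qed (use R0 in \<open>auto simp: levy_measure_measurable_iff\<close>)
  obtain C where C: "0 \<le> C"
    "\<And>z. norm z \<le> 1 \<Longrightarrow> \<bar>\<phi> (x + z) - \<phi> x - z \<bullet> grad \<phi> x\<bar> \<le> C * (norm z)\<^sup>2"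
    using C2_taylor_bound[OF \<phi>C2] by blast
  define N where "N z = indicator {z. norm z \<le> 1} z * levy_integrand \<phi> ?p x z" for z
  have intN: "integrable ?M N"
  proof (rule levy_integrable_of_bound[OF q])
    have [measurable]: "levy_integrand \<phi> ?p x \<in> borel_measurable borel"
      by (intro levy_integrand_measurable C2_borel \<phi>C2)
    show "N \<in> borel_measurable borel" unfolding N_def[abs_def] by measurable
    show "\<bar>N z\<bar> \<le> C * min 1 ((norm z)\<^sup>2)" for z
    proof (cases "norm z \<le> 1")
      case True
      hence "(norm z)\<^sup>2 \<le> 1" by (simp add: power_le_one)
      thus ?thesis using True C(2)[OF True] by (simp add: N_def levy_integrand_def)
    qed (use C in \<open>simp add: N_def\<close>)
  qed
  have "integrable ?M (\<lambda>z. indicator {z. 1 < norm z} z *\<^sub>R levy_integrand u ?p x z)"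
    using int by (intro integrable_mult_indicator) auto
  hence "integrable ?M (\<lambda>z. N z + indicator {z. 1 < norm z} z *\<^sub>R levy_integrand u ?p x z + R z)"
    by (intro Bochner_Integration.integrable_add intN intR)
  also have "(\<lambda>z. N z + indicator {z. 1 < norm z} z *\<^sub>R levy_integrand u ?p x z + R z) =
      levy_integrand \<psi> ?p x"
  proof
    fix z
    show "N z + indicator {z. 1 < norm z} z *\<^sub>R levy_integrand u ?p x z + R z =
        levy_integrand \<psi> ?p x z"
      by (cases "norm z \<le> 1")
         (auto simp: N_def R_def levy_integrand_def \<psi>_def G_near w_def \<phi>x)
  qed
  finally show thesis using that touch gr by metis
qed

lemma subsolution_C_imp_B:
  fixes q :: "real^'n \<Rightarrow> real"
  assumes q: "levy_density q" and C: "viscosity_subsolution_C \<Omega> F q u"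
  shows "viscosity_subsolution_B \<Omega> F q u"
  unfolding viscosity_subsolution_B_def
proof (intro conjI ballI allI impI)
  show u: "u \<in> USC" using C by (simp add: viscosity_subsolution_C_def)
  fix x \<phi> assume x: "x \<in> \<Omega>" and \<phi>: "touches_above \<phi> u x"
  let ?M = "levy_measure q" and ?p = "grad \<phi> x"
  have int: "integrable ?M (levy_integrand u ?p x)"
    and F: "F x (u x) ?p (hessian \<phi> x) \<le> (\<integral>z. levy_integrand u ?p x z \<partial>?M)"
    using C x \<phi> by (auto simp: viscosity_subsolution_C_def)
  have meas: "levy_integrand \<phi> ?p x \<in> borel_measurable ?M"
    using \<phi> unfolding levy_measure_measurable_iff touches_above_def
    by (intro levy_integrand_measurable C2_borel) simp
  have le: "levy_integrand u ?p x z \<le> levy_integrand \<phi> ?p x z" for z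
    using \<phi> by (auto simp: levy_integrand_def touches_above_def)
  show "has_ext_integral ?M (levy_integrand \<phi> ?p x)"
    by (rule ext_integral_ge_of_integrable(1)[OF int meas le])
  have "ereal (F x (u x) ?p (hessian \<phi> x)) \<le> ereal (\<integral>z. levy_integrand u ?p x z \<partial>?M)"
    using F by simp
  also have "\<dots> \<le> ext_integral ?M (levy_integrand \<phi> ?p x)"
    by (rule ext_integral_ge_of_integrable(2)[OF int meas le])
  finally show "ereal (F x (u x) ?p (hessian \<phi> x)) - ext_integral ?M (levy_integrand \<phi> ?p x) \<le> 0"
    by (cases "ext_integral ?M (levy_integrand \<phi> ?p x)") auto
  show "\<exists>\<psi>. touches_above \<psi> u x \<and> integrable ?M (levy_integrand \<psi> (grad \<psi> x) x)"
    using integrable_touching_function[OF q u \<phi> int] by metis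
qed

section \<open>Reflection to supersolutions\<close>

text \<open>The operator of the equation satisfied by \<open>- v\<close>: the function \<open>v\<close> is a supersolution for \<open>F\<close>
  if and only if \<open>- v\<close> is a subsolution for the reflected operator.\<close>

definition reflected_operator ::
    "(real^'n \<Rightarrow> real \<Rightarrow> real^'n \<Rightarrow> real^'n^'n \<Rightarrow> real) \<Rightarrow>
     real^'n \<Rightarrow> real \<Rightarrow> real^'n \<Rightarrow> real^'n^'n \<Rightarrow> real" where
  "reflected_operator F x r p X = - F x (- r) (- p) (- X)"

lemma uminus_USC_iff: "(\<lambda>y. - v y) \<in> USC \<longleftrightarrow> v \<in> LSC"
proof -
  have "(\<forall>c. - v x < c \<longrightarrow> (\<forall>\<^sub>F y in nhds x. - v y < c)) \<longleftrightarrow>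
      (\<forall>c. c < v x \<longrightarrow> (\<forall>\<^sub>F y in nhds x. c < v y))" (is "(\<forall>c. ?P c) \<longleftrightarrow> (\<forall>c. ?Q c)") for x
  proof -
    have PQ: "?P c \<longleftrightarrow> ?Q (- c)" for c by (simp add: minus_less_iff)
    show ?thesis
    proof (intro iffI allI)
      fix c assume "\<forall>c. ?P c"
      hence "?P (- c)" ..
      thus "?Q c" by (simp only: PQ minus_minus)
    next
      fix c assume "\<forall>c. ?Q c"
      hence "?Q (- c)" ..
      thus "?P c" by (simp only: PQ)
    qed
  qed
  thus ?thesis by (simp add: USC_def LSC_def)
qed

lemma grad_minus: "\<phi> \<in> C2 \<Longrightarrow> grad (\<lambda>y. - \<phi> y) x = - grad \<phi> x"
  using has_grad_hessD(2)[OF has_grad_hess_minus[OF C2_has_grad_hess]] by metis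

lemma hessian_minus: "\<phi> \<in> C2 \<Longrightarrow> hessian (\<lambda>y. - \<phi> y) x = - hessian \<phi> x"
  using has_grad_hessD(3)[OF has_grad_hess_minus[OF C2_has_grad_hess]] by metis

lemma touches_above_minus:
  "touches_above (\<lambda>y. - \<phi> y) (\<lambda>y. - v y) x \<longleftrightarrow> touches_below \<phi> v x"
  using C2_minus[of \<phi>] C2_minus[of "\<lambda>y. - \<phi> y"]
  by (auto simp: touches_above_def touches_below_def)

lemma all_touches_above_minus:
  "(\<forall>\<phi>. touches_above \<phi> (\<lambda>y. - v y) x \<longrightarrow> P \<phi>) \<longleftrightarrow>
   (\<forall>\<phi>. touches_below \<phi> v x \<longrightarrow> P (\<lambda>y. - \<phi> y))"
  (is "?L \<longleftrightarrow> ?R")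
proof
  assume ?R
  show ?L
  proof (intro allI impI)
    fix \<phi> assume "touches_above \<phi> (\<lambda>y. - v y) x"
    hence "touches_below (\<lambda>y. - \<phi> y) v x" by (simp add: touches_above_minus[symmetric])
    with \<open>?R\<close> show "P \<phi>" by fastforce
  qed
qed (simp add: touches_above_minus)

lemma levy_integrand_minus:
  "levy_integrand (\<lambda>y. - w y) (- p) x = (\<lambda>z. - levy_integrand w p x z)"
  by (rule ext) (simp add: levy_integrand_def)

lemma has_ext_integral_minus: "has_ext_integral M (\<lambda>z. - f z) \<longleftrightarrow> has_ext_integral M f"
  by (auto simp: has_ext_integral_def)

lemma ext_integral_minus:
  assumes "has_ext_integral M f"
  shows "ext_integral M (\<lambda>z. - f z) = - ext_integral M f"
  using assms unfolding has_ext_integral_def ext_integral_def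
  by (cases "\<integral>\<^sup>+z. ennreal (f z) \<partial>M"; cases "\<integral>\<^sup>+z. ennreal (- f z) \<partial>M") auto

lemma subsolution_C_minus:
  "viscosity_subsolution_C \<Omega> (reflected_operator F) q (\<lambda>y. - v y) \<longleftrightarrow>
   viscosity_supersolution_C \<Omega> F q v"
  unfolding viscosity_subsolution_C_def viscosity_supersolution_C_def uminus_USC_iff
    all_touches_above_minus
  by (intro conj_cong ball_cong all_cong1 imp_cong refl)
     (auto simp: touches_below_def grad_minus hessian_minus levy_integrand_minus
       reflected_operator_def)

lemma subsolution_B_minus:
  "viscosity_subsolution_B \<Omega> (reflected_operator F) q (\<lambda>y. - v y) \<longleftrightarrow>
   viscosity_supersolution_B \<Omega> F q v"
proof -
  have ex: "(\<exists>\<psi>. touches_above \<psi> (\<lambda>y. - v y) x \<and>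
        integrable (levy_measure q) (levy_integrand \<psi> (grad \<psi> x) x)) \<longleftrightarrow>
      (\<exists>\<psi>. touches_below \<psi> v x \<and>
        integrable (levy_measure q) (levy_integrand \<psi> (grad \<psi> x) x))" for x
  proof -
    have "(\<forall>\<psi>. touches_above \<psi> (\<lambda>y. - v y) x \<longrightarrow>
          \<not> integrable (levy_measure q) (levy_integrand \<psi> (grad \<psi> x) x)) \<longleftrightarrow>
        (\<forall>\<psi>. touches_below \<psi> v x \<longrightarrow>
          \<not> integrable (levy_measure q) (levy_integrand \<psi> (grad \<psi> x) x))"
      unfolding all_touches_above_minus
      by (intro all_cong1 imp_cong refl)
         (auto simp: touches_below_def grad_minus levy_integrand_minus)
    thus ?thesis by blast
  qed
  have ineq: "ereal (- a) + I \<le> 0 \<longleftrightarrow> 0 \<le> ereal a - I" for a :: real and I :: ereal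
    by (cases I) auto
  show ?thesis
    unfolding viscosity_subsolution_B_def viscosity_supersolution_B_def uminus_USC_iff
      all_touches_above_minus ex
    by (intro conj_cong ball_cong all_cong1 imp_cong refl)
       (auto simp: touches_below_def grad_minus hessian_minus levy_integrand_minus
         has_ext_integral_minus ext_integral_minus reflected_operator_def ineq
         simp del: uminus_ereal.simps)
qed

theorem theorem1:
  fixes \<Omega> :: "(real^'n) set"
    and F :: "real^'n \<Rightarrow> real \<Rightarrow> real^'n \<Rightarrow> real^'n^'n \<Rightarrow> real"
    and q :: "real^'n \<Rightarrow> real"
  assumes "continuous_operator \<Omega> F"
    and "elliptic_operator \<Omega> F"
    and "levy_density q"
  shows "((\<forall>u. viscosity_subsolution_B \<Omega> F q u \<longrightarrow> viscosity_subsolution_C \<Omega> F q u) \<and>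
          (\<forall>v. viscosity_supersolution_B \<Omega> F q v \<longrightarrow> viscosity_supersolution_C \<Omega> F q v)) \<and>
         ((\<forall>u. viscosity_subsolution_C \<Omega> F q u \<longrightarrow> viscosity_subsolution_B \<Omega> F q u) \<and>
          (\<forall>v. viscosity_supersolution_C \<Omega> F q v \<longrightarrow> viscosity_supersolution_B \<Omega> F q v))"
  using subsolution_B_imp_C[OF assms(3)] subsolution_C_imp_B[OF assms(3)]
    subsolution_C_minus subsolution_B_minus by metis

end
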